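(* Let $X=\sum_{j\ge0}(-\lambda)^jX_j$ be the formal power series solution of $\partial_tX=\Delta X-m_0^2X-\lambda X^p+\eta$ ($t>0$), $X(0,\cdot)=f$. Then for all $n\ge1$ and $x_1,\dots,x_n\in\Gamma$ the moments of $X$ are given, in the sense of formal power series in $\lambda$, by the sum over all generalized Parisi–Wu graphs $$\Big\langle\prod_{i=1}^nX(x_i,\eta)\Big\rangle=\sum_{m=0}^\infty(-\lambda)^m\sum_{\mathcal G\in P(m,n)}\mathcal P[\mathcal G](x_1,\dots,x_n).$$
   Context: Fix integers $d,p\ge1$ and reals $\delta>0$, $m_0>0$. Let $L_\delta=\delta\mathbb Z^d$ and $\Gamma=\mathbb R\times L_\delta$, with points $x=(t,\mathbf x)$ and $|x|^2=t^2+|\mathbf x|^2$. Put $\int g(\mathbf x)\,d\mathbf x=\sum_{\mathbf x\in L_\delta}\delta^dg(\mathbf x)$ and $\int g(x)\,dx=\sum_{\mathbf x\in L_\delta}\delta^d\int_{\mathbb R}g(t,\mathbf x)\,dt$. Convolutions: $(g*h)(x)=\int g(x-y)h(y)\,dy$ on $\Gamma$ and $(g\star h)(\mathbf x)=\int g(\mathbf x-\mathbf y)h(\mathbf y)\,d\mathbf y$ on $L_\delta$. Lattice Laplacian: $\Delta g(\mathbf x)=\delta^{-2}\big[-2d\,g(\mathbf x)+\sum_{|\mathbf y-\mathbf x|=\delta}g(\mathbf y)\big]$. Let $\mu^2(\mathbf p)=2\delta^{-2}\big(d-\sum_{j=1}^d\cos(\delta p_j)\big)+m_0^2$, $\tilde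 G_t(\mathbf x)=(2\pi)^{-d}\int_{[0,2\pi/\delta]^d}e^{-i\mathbf p\cdot\mathbf x}e^{-t\mu^2(\mathbf p)}\,d\mathbf p$ for $t\ge0$, and $G(t,\mathbf x)=\theta(t)\tilde G_t(\mathbf x)$ with $\theta(t)=1$ if $t>0$ and $\theta(t)=0$ otherwise. Noise and solution. $f\in S(L_\delta)$ (rapidly decreasing functions). The noise $\eta$ is a random tempered distribution on $\Gamma$ supported in $\{t\ge0\}$ such that $G*\eta\in\mathcal M_b$ almost surely, where $\mathcal M_b$ is the space of measurable $g:\Gamma\to\mathbb R$ such that for every $k\in\mathbb N$ there is $N\in\mathbb N$ with $\int|g(x)|^k(1+|x|^2)^{-N}dx<\infty$. The formal power series solution $X=\sum_{j\ge0}(-\lambda)^jX_j$ is the one solving $X=-\lambda G*(X^p)+G*\eta+\tilde G_t\star f$ order by order ($\tilde G_t\star f$ being set to $0$ for $t\le0$), i.e. $X_0=G*\eta+\tilde G_t\star f$ and, for $j\ge1$, $X_j=G*\sum\frac{p!}{n_0!n_1!\cdots}\prod_{i\ge0}X_i^{n_i}$, the sum running over nonnegative integers $n_0,n_1,\dots$ with $\sum_in_i=p$, $\sum_i i\,n_i=j-1$. Write $X(x,\eta)$, $X_j(x,\eta)$ for values at $x$. $\langle\cdot\rangle$ is expectation, and $\langle\prod_iX(x_i,\eta)\rangle$ is the formal power series obtained by multiplying out and taking expectations of the coefficients. Moments of the noise. $\eta$ has moment functions $\langle\eta(z_1)\cdots\eta(z_n)\rangle$ of every order (generalized functions or signed measures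 in $z_1,\dots,z_n$). It is assumed that all integrals below converge and that the expectation of a product of tree values (defined below) is computed by replacing the product of the factors $\eta(z)$ under the integral by the corresponding moment function. The truncated moment functions are defined recursively by $\langle\prod_{i=1}^n\eta(z_i)\rangle=\sum_{I}\prod_{l=1}^k\langle\prod_{j\in I_l}\eta(z_j)\rangle^T$, the sum running over all partitions $I=\{I_1,\dots,I_k\}$ of $\{1,\dots,n\}$ into nonempty blocks. Trees. $\mathcal A(j)$ is the set of rooted trees with a root of degree one, $j$ inner vertices each having $p+1$ legs, all other vertices being leaves of degree one, each leaf being either of type one or of type two. $\mathcal A(0)$ has two elements: the root joined to a single leaf of type one, respectively of type two. For $j\ge1$, a tree $T\in\mathcal A(j)$ is obtained by joining the root to an inner vertex $v_0$ to which $p$ rooted trees with root $v_0$ are attached, $n_i$ of them from $\mathcal A(i)$, with $\sum_in_i=p$ and $\sum_i i\,n_i=j-1$. $T$ is specified by the $n_i$, by the number $n_0'\le n_0$ of attached elements of $\mathcal A(0)$ whose leaf is of type one, and, for each $i\ge1$, by the list $(T_{i,1},\dots,T_{i,n_i})$ of attached elements of $\mathcal A(i)$; the order of the attached elements of $\mathcal A(0)$ is immaterial, while for $i\ge1$ different lists give different elements of $\mathcal A(j)$. For vertices, $v\le w$ means every walk from $w$ to the root passes through $v$. For an inner vertex $v$, $M(v)=\frac{p!}{n_0'!\,(n_0-n_0')!\,n_1!\,n_2!\cdots}$, where $n_i$ is the number of rooted subtrees attached at $v$ (away from the root) with $i$ inner vertices, and $n_0'$ the number of those with no inner vertex and a leaf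 of type one; $M(T)=\prod_vM(v)$. $L_1(T)$ is the set of leaves of type one. The value of $T\in\mathcal A(j)$ is $\mathcal B(T,x,\eta)=M(T)\int\prod_eG(e)\prod\eta(z_r)\prod f(\mathbf z'_r)\,dy\,dz\,d\mathbf z'$, with root placed at $x$, inner vertices at $y_r\in\Gamma$, leaves of type one at $z_r\in\Gamma$, leaves of type two at $(0,\mathbf z_r')$, $\mathbf z'_r\in L_\delta$, and $G(e)=G(v-w)$ for an edge $e=\{v,w\}$ with $v\le w$. Graphs. A generalized Parisi–Wu graph of order $m$ with $n$ roots consists of $n$ rooted trees $T_1\in\mathcal A(j_1),\dots,T_n\in\mathcal A(j_n)$, $j_1+\dots+j_n=m$, together with additional "empty" vertices, such that each leaf of type one is joined by an edge to exactly one empty vertex, each empty vertex having at least one leg (and arbitrary degree). Empty vertices are not distinguishable, so such a graph is the same as a tuple $(T_1,\dots,T_n;I)$ with $I$ a partition of the disjoint union $\bigcup_iL_1(T_i)$, the blocks being the sets of leaves joined to a common empty vertex; graphs are counted as such tuples (leaves are treated as distinct elements). $P(m,n)$ is the set of these graphs. Value. $\mathcal P[\mathcal G](x_1,\dots,x_n)$: assign $x_1,\dots,x_n$ to the roots, variables $y_1,\dots,y_m\in\Gamma$ to the inner vertices of the trees, $z_1,\dots,z_k\in\Gamma$ to the leaves of type one, $\mathbf z_1',\dots,\mathbf z_l'\in L_\delta$ to the leaves of type two (placed at $(0,\mathbf z'_r)$). Multiply $G(e)=G(v-w)$ over all edges $e=\{v,w\}$, $v\le w$, of the trees; a factor $\langle\eta(q_1)\cdots\eta(q_s)\rangle^T$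 for each empty vertex with $s$ legs joined to leaves with arguments $q_1,\dots,q_s$; a factor $f(\mathbf z_r')$ for each leaf of type two; a factor $M(v)$ for each inner vertex $v$ of a tree; and integrate over $dy_1\cdots dy_m\,dz_1\cdots dz_k\,d\mathbf z_1'\cdots d\mathbf z_l'$. *)

theory Defs
  imports "HOL-Probability.Probability" "HOL-Computational_Algebra.Formal_Power_Series"
begin

section \<open>Space-time, test functions and the Green function\<close>

text \<open>The spatial dimension is \<open>d = CARD('d)\<close>. Points of \<open>\<Gamma>\<close> are pairs \<open>(t, \<^bold>x)\<close>, and
  \<open>norm (t, \<^bold>x)\<close> is the Euclidean norm \<open>sqrt (t^2 + |\<^bold>x|^2)\<close>.\<close>

type_synonym 'd point = "real \<times> (real ^ 'd)"

definition lat :: "real \<Rightarrow> (real ^ 'd::finite) set" where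
  "lat \<delta> = {v. \<forall>i. \<exists>k::int. v $ i = \<delta> * of_int k}"

definition Gam :: "real \<Rightarrow> 'd::finite point set" where
  "Gam \<delta> = UNIV \<times> lat \<delta>"

definition lat_measure :: "real \<Rightarrow> (real ^ 'd::finite) measure" where
  "lat_measure \<delta> = density (count_space (lat \<delta>)) (\<lambda>_. ennreal (\<delta> ^ CARD('d)))"

definition Gam_measure :: "real \<Rightarrow> 'd::finite point measure" where
  "Gam_measure \<delta> = lborel \<Otimes>\<^sub>M lat_measure \<delta>"

definition schwartz_lat :: "real \<Rightarrow> (real ^ 'd::finite \<Rightarrow> real) set" where
  "schwartz_lat \<delta> = {f. \<forall>N. bdd_above ((\<lambda>v. (1 + (norm v)\<^sup>2) ^ N * \<bar>f v\<bar>) ` lat \<delta>)}"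

definition time_deriv :: "nat \<Rightarrow> ('d::finite point \<Rightarrow> real) \<Rightarrow> 'd point \<Rightarrow> real" where
  "time_deriv k \<phi> x = (deriv ^^ k) (\<lambda>s. \<phi> (s, snd x)) (fst x)"

text \<open>Functions on \<open>\<Gamma>\<close> are total functions here; a Schwartz function is made unique by letting it
  vanish off \<open>\<Gamma>\<close>.\<close>

definition schwartz :: "real \<Rightarrow> ('d::finite point \<Rightarrow> real) set" where
  "schwartz \<delta> = {\<phi>. (\<forall>x. x \<notin> Gam \<delta> \<longrightarrow> \<phi> x = 0) \<and>
     (\<forall>k. (\<forall>v\<in>lat \<delta>. \<forall>t. (\<lambda>s. time_deriv k \<phi> (s, v)) differentiable (at t)) \<and>
          (\<forall>N. bdd_above ((\<lambda>x. (1 + (norm x)\<^sup>2) ^ N * \<bar>time_deriv k \<phi> x\<bar>) ` Gam \<delta>)))}"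

definition schwartz_norm :: "real \<Rightarrow> nat \<Rightarrow> nat \<Rightarrow> ('d::finite point \<Rightarrow> real) \<Rightarrow> real" where
  "schwartz_norm \<delta> k N \<phi> = (SUP x\<in>Gam \<delta>. (1 + (norm x)\<^sup>2) ^ N * \<bar>time_deriv k \<phi> x\<bar>)"

definition tempered_distribution :: "real \<Rightarrow> (('d::finite point \<Rightarrow> real) \<Rightarrow> real) \<Rightarrow> bool" where
  "tempered_distribution \<delta> u \<longleftrightarrow>
     (\<forall>\<phi>\<in>schwartz \<delta>. \<forall>\<psi>\<in>schwartz \<delta>. \<forall>a b. u (\<lambda>x. a * \<phi> x + b * \<psi> x) = a * u \<phi> + b * u \<psi>) \<and>
     (\<exists>C K N. \<forall>\<phi>\<in>schwartz \<delta>. \<bar>u \<phi>\<bar> \<le> C * (\<Sum>k\<le>K. schwartz_norm \<delta> k N \<phi>))"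

definition supported_in_future :: "real \<Rightarrow> (('d::finite point \<Rightarrow> real) \<Rightarrow> real) \<Rightarrow> bool" where
  "supported_in_future \<delta> u \<longleftrightarrow>
     (\<forall>\<phi>\<in>schwartz \<delta>. closure {x. \<phi> x \<noteq> 0} \<inter> {x. fst x \<ge> 0} = {} \<longrightarrow> u \<phi> = 0)"

definition random_noise ::
    "'w measure \<Rightarrow> real \<Rightarrow> ('w \<Rightarrow> ('d::finite point \<Rightarrow> real) \<Rightarrow> real) \<Rightarrow> bool" where
  "random_noise M \<delta> \<eta> \<longleftrightarrow>
     (\<forall>\<omega>\<in>space M. tempered_distribution \<delta> (\<eta> \<omega>) \<and> supported_in_future \<delta> (\<eta> \<omega>)) \<and>
     (\<forall>\<phi>\<in>schwartz \<delta>. (\<lambda>\<omega>. \<eta> \<omega> \<phi>) \<in> borel_measurable M)"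

definition Mb :: "real \<Rightarrow> ('d::finite point \<Rightarrow> real) set" where
  "Mb \<delta> = {g. g \<in> borel_measurable (Gam_measure \<delta>) \<and>
     (\<forall>k. \<exists>N. integrable (Gam_measure \<delta>) (\<lambda>x. \<bar>g x\<bar> ^ k / (1 + (norm x)\<^sup>2) ^ N))}"

definition mu_sq :: "real \<Rightarrow> real \<Rightarrow> real ^ 'd::finite \<Rightarrow> real" where
  "mu_sq \<delta> m0 q = 2 / \<delta>\<^sup>2 * (real CARD('d) - (\<Sum>j\<in>UNIV. cos (\<delta> * q $ j))) + m0\<^sup>2"

definition G_tilde_complex :: "real \<Rightarrow> real \<Rightarrow> real \<Rightarrow> real ^ 'd::finite \<Rightarrow> complex" where
  "G_tilde_complex \<delta> m0 t v = 1 / (2 * of_real pi) ^ CARD('d) *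
     (LINT q:cbox 0 (\<chi> i. 2 * pi / \<delta>)|lborel.
        exp (- (\<i> * of_real (q \<bullet> v))) * exp (- of_real (t * mu_sq \<delta> m0 q)))"

text \<open>On the lattice the Fourier integral is real, so taking the real part only changes the type.\<close>

lemma G_tilde_complex_real:
  fixes v :: "real ^ 'd::finite"
  assumes "\<delta> > 0" and v: "v \<in> lat \<delta>"
  shows "complex_of_real (Re (G_tilde_complex \<delta> m0 t v)) = G_tilde_complex \<delta> m0 t v"
proof -
  define c :: "real ^ 'd" where "c = (\<chi> i. 2 * pi / \<delta>)"
  define F :: "real ^ 'd \<Rightarrow> complex" where
    "F q = indicator (cbox 0 c) q *\<^sub>R
      (exp (- (\<i> * of_real (q \<bullet> v))) * exp (- of_real (t * mu_sq \<delta> m0 q)))" for q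
  have mu_c: "mu_sq \<delta> m0 (c - q) = mu_sq \<delta> m0 q" for q
  proof -
    have "cos (\<delta> * (c - q) $ j) = cos (\<delta> * q $ j)" for j
    proof -
      have "\<delta> * (c - q) $ j = 2 * pi - \<delta> * q $ j"
        using assms(1) by (simp add: c_def field_simps)
      then show ?thesis by (simp add: cos_diff)
    qed
    then show ?thesis by (simp add: mu_sq_def)
  qed
  obtain k :: "'d \<Rightarrow> int" where k: "v $ i = \<delta> * of_int (k i)" for i
    using v unfolding lat_def by auto metis
  have cv: "c \<bullet> v = 2 * pi * of_int (\<Sum>i\<in>UNIV. k i)"
    using assms(1) by (simp add: inner_vec_def c_def k sum_distrib_left mult.assoc)
  have exp_c: "exp (\<i> * of_real (c \<bullet> v)) = 1"
    unfolding cv exp_eq_1 by (auto intro!: exI[of _ "\<Sum>i\<in>UNIV. k i"])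
  have box: "c - q \<in> cbox 0 c \<longleftrightarrow> q \<in> cbox 0 c" for q :: "real ^ 'd"
    by (auto simp: mem_box_cart)
  have F_c: "F (c - q) = cnj (F q)" for q
  proof -
    have "exp (- (\<i> * of_real ((c - q) \<bullet> v))) =
        exp (- (\<i> * of_real (c \<bullet> v))) * exp (\<i> * of_real (q \<bullet> v))"
      by (simp add: inner_diff_left exp_add[symmetric] algebra_simps)
    also have "exp (- (\<i> * of_real (c \<bullet> v))) = 1"
      using exp_c by (simp add: exp_minus)
    finally have "exp (- (\<i> * of_real ((c - q) \<bullet> v))) = exp (\<i> * of_real (q \<bullet> v))" by simp
    then show ?thesis
      unfolding F_def mu_c by (auto simp: indicator_def box exp_cnj)
  qed
  have [measurable]: "F \<in> borel_measurable borel"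
    unfolding F_def mu_sq_def by measurable
  have "lborel = distr lborel borel (\<lambda>q. c - q)"
    using lborel_affine[of "-1" c] by (simp add: density_1)
  then have "(LINT q|lborel. F q) = (LINT q|distr lborel borel (\<lambda>q. c - q). F q)"
    by simp
  also have "\<dots> = (LINT q|lborel. F (c - q))"
    by (subst integral_distr) auto
  also have "\<dots> = cnj (LINT q|lborel. F q)"
    by (simp add: F_c)
  finally have "(LINT q|lborel. F q) \<in> \<real>"
    by (metis Reals_cnj_iff)
  moreover have "G_tilde_complex \<delta> m0 t v =
      of_real (1 / (2 * pi) ^ CARD('d)) * (LINT q|lborel. F q)"
    unfolding G_tilde_complex_def set_lebesgue_integral_def F_def c_def by simp
  ultimately have "G_tilde_complex \<delta> m0 t v \<in> \<real>"
    by (auto intro!: Reals_mult)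
  then show ?thesis by (simp add: of_real_Re)
qed

definition G_tilde :: "real \<Rightarrow> real \<Rightarrow> real \<Rightarrow> real ^ 'd::finite \<Rightarrow> real" where
  "G_tilde \<delta> m0 t v = Re (G_tilde_complex \<delta> m0 t v)"

definition green :: "real \<Rightarrow> real \<Rightarrow> 'd::finite point \<Rightarrow> real" where
  "green \<delta> m0 x = (if fst x > 0 then G_tilde \<delta> m0 (fst x) (snd x) else 0)"

text \<open>\<open>g\<close> is a (pointwise defined) version of \<open>G * u\<close> for a distribution \<open>u\<close>: the convolution is
  defined by duality, \<open>(G * u)(\<phi>) = u (\<lambda>z. \<integral> G (x - z) \<phi>(x) dx)\<close>.\<close>

definition is_green_conv ::
    "real \<Rightarrow> real \<Rightarrow> (('d::finite point \<Rightarrow> real) \<Rightarrow> real) \<Rightarrow> ('d point \<Rightarrow> real) \<Rightarrow> bool" where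
  "is_green_conv \<delta> m0 u g \<longleftrightarrow> (\<forall>\<phi>\<in>schwartz \<delta>.
     u (\<lambda>z. if z \<in> Gam \<delta> then LINT x|Gam_measure \<delta>. green \<delta> m0 (x - z) * \<phi> x else 0) =
     (LINT x|Gam_measure \<delta>. g x * \<phi> x))"

section \<open>The formal power series solution\<close>

definition exponents :: "nat \<Rightarrow> nat \<Rightarrow> (nat \<Rightarrow> nat) set" where
  "exponents p j = {n. (\<forall>i>j. n i = 0) \<and> (\<Sum>i\<le>j. n i) = p \<and> (\<Sum>i\<le>j. i * n i) = j}"

text \<open>\<open>g\<close> stands for a realisation of \<open>G * \<eta>\<close>. The step from \<open>j\<close> to \<open>Suc j\<close> uses the exponents of
  weight \<open>j\<close>, for which automatically \<open>n i = 0\<close> when \<open>i > j\<close>.\<close>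

function X_coeff :: "real \<Rightarrow> real \<Rightarrow> nat \<Rightarrow> (real ^ 'd::finite \<Rightarrow> real) \<Rightarrow> ('d point \<Rightarrow> real) \<Rightarrow>
    nat \<Rightarrow> 'd point \<Rightarrow> real" where
  "X_coeff \<delta> m0 p f g 0 x = g x +
     (if fst x > 0 then LINT v|lat_measure \<delta>. G_tilde \<delta> m0 (fst x) (snd x - v) * f v else 0)"
| "X_coeff \<delta> m0 p f g (Suc j) x =
     (LINT y|Gam_measure \<delta>. green \<delta> m0 (x - y) *
        (\<Sum>n\<in>exponents p j. fact p / (\<Prod>i\<le>j. fact (n i)) *
           (\<Prod>i\<le>j. X_coeff \<delta> m0 p f g i y ^ n i)))"
  by pat_completeness auto
termination
  by (relation "Wellfounded.measure (\<lambda>(_, _, _, _, _, j, _). j)") auto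

definition X_series :: "real \<Rightarrow> real \<Rightarrow> nat \<Rightarrow> (real ^ 'd::finite \<Rightarrow> real) \<Rightarrow> ('d point \<Rightarrow> real) \<Rightarrow>
    'd point \<Rightarrow> real fps" where
  "X_series \<delta> m0 p f g x = Abs_fps (\<lambda>j. (-1) ^ j * X_coeff \<delta> m0 p f g j x)"

definition fps_expectation :: "'w measure \<Rightarrow> ('w \<Rightarrow> real fps) \<Rightarrow> real fps" where
  "fps_expectation M F = Abs_fps (\<lambda>m. LINT \<omega>|M. fps_nth (F \<omega>) m)"

section \<open>Moment functions and truncation\<close>

definition tensor :: "('a \<Rightarrow> real) list \<Rightarrow> (nat \<Rightarrow> 'a) \<Rightarrow> real" where
  "tensor gs z = (\<Prod>a<length gs. (gs ! a) (z a))"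

text \<open>The \<open>n\<close>-th moment function is a linear functional
  \<open>\<mu> n F = \<integral> F (z\<^sub>1, \<dots>, z\<^sub>n) \<langle>\<eta> (z\<^sub>1) \<cdots> \<eta> (z\<^sub>n)\<rangle> dz\<close>
  on a linear space \<open>D n\<close> of functions \<open>F\<close> on \<open>\<Gamma>\<^sup>n\<close>, the functions that can be integrated against
  it. For a signed measure \<open>D n\<close> consists of the integrable functions; for a generalized function
  \<open>D n\<close> contains the test functions and those further functions to which the pairing extends.
  By the kernel theorem the values on products of test functions determine the generalized
  function.\<close>

definition moment_functions :: "'w measure \<Rightarrow> real \<Rightarrow> ('w \<Rightarrow> ('d::finite point \<Rightarrow> real) \<Rightarrow> real) \<Rightarrow>
    (nat \<Rightarrow> ((nat \<Rightarrow> 'd point) \<Rightarrow> real) set) \<Rightarrow> (nat \<Rightarrow> ((nat \<Rightarrow> 'd point) \<Rightarrow> real) \<Rightarrow> real) \<Rightarrow> bool" where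
  "moment_functions M \<delta> \<eta> D \<mu> \<longleftrightarrow>
     (\<forall>n. \<forall>F\<in>D n. \<forall>H\<in>D n. \<forall>a b. (\<lambda>z. a * F z + b * H z) \<in> D n \<and>
        \<mu> n (\<lambda>z. a * F z + b * H z) = a * \<mu> n F + b * \<mu> n H) \<and>
     (\<forall>n. \<forall>F\<in>D n. \<forall>H. (\<forall>z\<in>{..<n} \<rightarrow>\<^sub>E Gam \<delta>. H z = F z) \<longrightarrow> H \<in> D n \<and> \<mu> n H = \<mu> n F) \<and>
     (\<forall>\<phi>s. set \<phi>s \<subseteq> schwartz \<delta> \<longrightarrow>
        integrable M (\<lambda>\<omega>. \<Prod>a<length \<phi>s. \<eta> \<omega> (\<phi>s ! a)) \<and>
        tensor \<phi>s \<in> D (length \<phi>s) \<and>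
        \<mu> (length \<phi>s) (tensor \<phi>s) = (LINT \<omega>|M. (\<Prod>a<length \<phi>s. \<eta> \<omega> (\<phi>s ! a))))"

definition moment :: "(nat \<Rightarrow> ((nat \<Rightarrow> 'a) \<Rightarrow> real) \<Rightarrow> real) \<Rightarrow> ('a \<Rightarrow> real) list \<Rightarrow> real" where
  "moment \<mu> gs = \<mu> (length gs) (tensor gs)"

lemma length_nths_block:
  assumes "partition_on {..<n} I" "I \<noteq> {{..<n}}" "B \<in> I" "length gs = n"
  shows "length (nths gs B) < length gs"
proof -
  have sub: "B \<subseteq> {..<n}"
    using assms(1,3) by (auto simp: partition_on_def)
  have "B \<noteq> {..<n}"
  proof
    assume B: "B = {..<n}"
    have "C = B" if "C \<in> I" for C
    proof (rule ccontr)
      assume "C \<noteq> B"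
      then have "C \<inter> B = {}"
        using assms(1,3) that by (auto simp: partition_on_def disjoint_def)
      moreover have "C \<subseteq> B" "C \<noteq> {}"
        using assms(1) that B by (auto simp: partition_on_def)
      ultimately show False by blast
    qed
    then show False using assms(2,3) B by blast
  qed
  then have "B \<subset> {..<n}" using sub by blast
  then have "card B < n" using psubset_card_mono[of "{..<n}" B] by simp
  moreover have "{i. i < n \<and> i \<in> B} = B" using sub by auto
  ultimately show ?thesis by (simp add: length_nths assms(4))
qed

text \<open>\<open>truncated \<mu> [g\<^sub>1, \<dots>, g\<^sub>n] =
  \<integral> g\<^sub>1 (z\<^sub>1) \<cdots> g\<^sub>n (z\<^sub>n) \<langle>\<eta> (z\<^sub>1) \<cdots> \<eta> (z\<^sub>n)\<rangle>\<^sup>T dz\<close>: the recursion for the truncated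
  moment functions integrated against a product function. The blocks involve disjoint sets of
  variables, so each product over the blocks integrates to a product of numbers. The term of the
  one-block partition is the truncated moment function being defined.\<close>

function truncated :: "(nat \<Rightarrow> ((nat \<Rightarrow> 'a) \<Rightarrow> real) \<Rightarrow> real) \<Rightarrow> ('a \<Rightarrow> real) list \<Rightarrow> real" where
  "truncated \<mu> gs = moment \<mu> gs -
     (\<Sum>I\<in>{I. partition_on {..<length gs} I \<and> I \<noteq> {{..<length gs}}}.
        \<Prod>B\<in>I. truncated \<mu> (nths gs B))"
  by pat_completeness auto
termination
  by (relation "Wellfounded.measure (\<lambda>(_, gs). length gs)") (auto intro: length_nths_block)

declare truncated.simps [simp del]

section \<open>Trees and forests\<close>

text \<open>A rooted tree is represented by what hangs from its root (which has degree one): a leaf of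
  type one, a leaf of type two, or an inner vertex with its \<open>p\<close> attached trees. The attached
  trees are listed by increasing \<open>tree_rank\<close>: \<open>n\<^sub>0'\<close> leaves of type one, \<open>n\<^sub>0 - n\<^sub>0'\<close> leaves of type two,
  then the list \<open>(T\<^sub>1\<^sub>,\<^sub>1, \<dots>)\<close> of those with one inner vertex, the list of those with two, and so
  on. Hence the order of the leaves is immaterial, the order within each of these lists is not.\<close>

datatype pw_tree = Leaf1 | Leaf2 | Inner "pw_tree list"

fun num_inner :: "pw_tree \<Rightarrow> nat" where
  "num_inner Leaf1 = 0"
| "num_inner Leaf2 = 0"
| "num_inner (Inner ts) = Suc (sum_list (map num_inner ts))"

definition tree_rank :: "pw_tree \<Rightarrow> nat" where
  "tree_rank T = (case T of Leaf1 \<Rightarrow> 0 | Leaf2 \<Rightarrow> 1 | Inner _ \<Rightarrow> 1 + num_inner T)"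

fun well_formed :: "nat \<Rightarrow> pw_tree \<Rightarrow> bool" where
  "well_formed p Leaf1 \<longleftrightarrow> True"
| "well_formed p Leaf2 \<longleftrightarrow> True"
| "well_formed p (Inner ts) \<longleftrightarrow>
     length ts = p \<and> sorted (map tree_rank ts) \<and> (\<forall>t\<in>set ts. well_formed p t)"

definition trees :: "nat \<Rightarrow> nat \<Rightarrow> pw_tree set" where
  "trees p j = {T. well_formed p T \<and> num_inner T = j}"

text \<open>The multiplicity \<open>M(v)\<close> of an inner vertex \<open>v\<close> with attached trees \<open>ts\<close>: the classes of attached
  trees with equal \<open>tree_rank\<close> have sizes \<open>n\<^sub>0'\<close>, \<open>n\<^sub>0 - n\<^sub>0'\<close>, \<open>n\<^sub>1\<close>, \<open>n\<^sub>2\<close>, and so on.\<close>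

fun vertex_mult :: "pw_tree \<Rightarrow> real" where
  "vertex_mult (Inner ts) =
     fact (length ts) / (\<Prod>r\<in>set (map tree_rank ts). fact (count_list (map tree_rank ts) r))"
| "vertex_mult _ = 1"

text \<open>The vertices of a tree other than its root, each with the subtree hanging from it. A vertex is
  addressed by the list of child indices leading to it; its parent is \<open>butlast\<close> of the address, or
  the root if the address is \<open>[]\<close>.\<close>

function vertices :: "pw_tree \<Rightarrow> (nat list \<times> pw_tree) list" where
  "vertices Leaf1 = [([], Leaf1)]"
| "vertices Leaf2 = [([], Leaf2)]"
| "vertices (Inner ts) = ([], Inner ts) #
     concat (map (\<lambda>(k, t). map (\<lambda>(q, S). (k # q, S)) (vertices t)) (List.enumerate 0 ts))"
  by pat_completeness auto
termination
  by (relation "Wellfounded.measure size")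
    (auto simp: in_set_enumerate_eq intro!: size_list_estimation' le_imp_less_Suc)

text \<open>In a forest \<open>T\<^sub>0, \<dots>, T\<^sub>n\<^sub>-\<^sub>1\<close> a vertex is a pair of a tree index and an address.\<close>

type_synonym vertex = "nat \<times> nat list"

definition forest_vertices :: "pw_tree list \<Rightarrow> (vertex \<times> pw_tree) list" where
  "forest_vertices Ts =
     concat (map (\<lambda>(i, T). map (\<lambda>(q, S). ((i, q), S)) (vertices T)) (List.enumerate 0 Ts))"

definition inner_vertices :: "pw_tree list \<Rightarrow> vertex set" where
  "inner_vertices Ts = {v. \<exists>ts. (v, Inner ts) \<in> set (forest_vertices Ts)}"

definition leaves1 :: "pw_tree list \<Rightarrow> vertex list" where
  "leaves1 Ts = map fst (filter (\<lambda>(v, S). S = Leaf1) (forest_vertices Ts))"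

definition leaves2 :: "pw_tree list \<Rightarrow> vertex set" where
  "leaves2 Ts = {v. (v, Leaf2) \<in> set (forest_vertices Ts)}"

definition forest_mult :: "pw_tree list \<Rightarrow> real" where
  "forest_mult Ts = (\<Prod>(v, S)\<leftarrow>forest_vertices Ts. vertex_mult S)"

definition parent_pos ::
    "(nat \<Rightarrow> 'd::finite point) \<Rightarrow> (vertex \<Rightarrow> 'd point) \<Rightarrow> vertex \<Rightarrow> 'd point" where
  "parent_pos x y v = (if snd v = [] then x (fst v) else y (fst v, butlast (snd v)))"

text \<open>Integration over the positions \<open>y\<close> of the inner vertices and \<open>z'\<close> of the leaves of type two.\<close>

definition forest_measure ::
    "real \<Rightarrow> pw_tree list \<Rightarrow> ((vertex \<Rightarrow> 'd::finite point) \<times> (vertex \<Rightarrow> real ^ 'd)) measure" where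
  "forest_measure \<delta> Ts =
     (\<Pi>\<^sub>M v\<in>inner_vertices Ts. Gam_measure \<delta>) \<Otimes>\<^sub>M (\<Pi>\<^sub>M v\<in>leaves2 Ts. lat_measure \<delta>)"

text \<open>The part of the integrand not involving the leaves of type one, for roots at
  \<open>x 0, x 1, \<dots>\<close>.\<close>

definition forest_kernel :: "real \<Rightarrow> real \<Rightarrow> (real ^ 'd::finite \<Rightarrow> real) \<Rightarrow> pw_tree list \<Rightarrow>
    (nat \<Rightarrow> 'd point) \<Rightarrow> (vertex \<Rightarrow> 'd point) \<times> (vertex \<Rightarrow> real ^ 'd) \<Rightarrow> real" where
  "forest_kernel \<delta> m0 f Ts x = (\<lambda>(y, z').
     (\<Prod>v\<in>inner_vertices Ts. green \<delta> m0 (parent_pos x y v - y v)) *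
     (\<Prod>v\<in>leaves2 Ts. green \<delta> m0 (parent_pos x y v - (0, z' v)) * f (z' v)))"

text \<open>The functions \<open>z \<mapsto> G (w - z)\<close> of the position \<open>z\<close> of a leaf of type one with parent \<open>w\<close>,
  for a list of such leaves.\<close>

definition leaf_functions :: "real \<Rightarrow> real \<Rightarrow> (nat \<Rightarrow> 'd::finite point) \<Rightarrow> (vertex \<Rightarrow> 'd point) \<Rightarrow>
    vertex list \<Rightarrow> ('d point \<Rightarrow> real) list" where
  "leaf_functions \<delta> m0 x y vs = map (\<lambda>v z. green \<delta> m0 (parent_pos x y v - z)) vs"

text \<open>The value \<open>\<B>(T, x, \<eta>)\<close>: the integral of \<open>G (w - z) \<eta> (z)\<close> over the position of a leaf of type
  one with parent \<open>w\<close> is \<open>(G * \<eta>)(w)\<close>, here \<open>g w\<close>.\<close>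

definition tree_integrand :: "real \<Rightarrow> real \<Rightarrow> (real ^ 'd::finite \<Rightarrow> real) \<Rightarrow> ('d point \<Rightarrow> real) \<Rightarrow>
    pw_tree \<Rightarrow> 'd point \<Rightarrow> (vertex \<Rightarrow> 'd point) \<times> (vertex \<Rightarrow> real ^ 'd) \<Rightarrow> real" where
  "tree_integrand \<delta> m0 f g T x u = forest_kernel \<delta> m0 f [T] (\<lambda>_. x) u *
     (\<Prod>v\<leftarrow>leaves1 [T]. g (parent_pos (\<lambda>_. x) (fst u) v))"

definition tree_value :: "real \<Rightarrow> real \<Rightarrow> (real ^ 'd::finite \<Rightarrow> real) \<Rightarrow> ('d point \<Rightarrow> real) \<Rightarrow>
    pw_tree \<Rightarrow> 'd point \<Rightarrow> real" where
  "tree_value \<delta> m0 f g T x =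
     forest_mult [T] * (LINT u|forest_measure \<delta> [T]. tree_integrand \<delta> m0 f g T x u)"

section \<open>Generalized Parisi--Wu graphs\<close>

text \<open>A block of the partition is the set of leaves joined to a common empty vertex.\<close>

definition PW_graphs :: "nat \<Rightarrow> nat \<Rightarrow> nat \<Rightarrow> (pw_tree list \<times> vertex set set) set" where
  "PW_graphs p m n = {(Ts, I). length Ts = n \<and>
     (\<exists>j. (\<forall>i<n. Ts ! i \<in> trees p (j i)) \<and> (\<Sum>i<n. j i) = m) \<and>
     partition_on (set (leaves1 Ts)) I}"

definition graph_integrand :: "real \<Rightarrow> real \<Rightarrow> (real ^ 'd::finite \<Rightarrow> real) \<Rightarrow>
    (nat \<Rightarrow> ((nat \<Rightarrow> 'd point) \<Rightarrow> real) \<Rightarrow> real) \<Rightarrow> pw_tree list \<times> vertex set set \<Rightarrow>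
    (nat \<Rightarrow> 'd point) \<Rightarrow> (vertex \<Rightarrow> 'd point) \<times> (vertex \<Rightarrow> real ^ 'd) \<Rightarrow> real" where
  "graph_integrand \<delta> m0 f \<mu> = (\<lambda>(Ts, I) x u. forest_kernel \<delta> m0 f Ts x u *
     (\<Prod>B\<in>I. truncated \<mu> (leaf_functions \<delta> m0 x (fst u) (filter (\<lambda>v. v \<in> B) (leaves1 Ts)))))"

definition graph_value :: "real \<Rightarrow> real \<Rightarrow> (real ^ 'd::finite \<Rightarrow> real) \<Rightarrow>
    (nat \<Rightarrow> ((nat \<Rightarrow> 'd point) \<Rightarrow> real) \<Rightarrow> real) \<Rightarrow> pw_tree list \<times> vertex set set \<Rightarrow>
    (nat \<Rightarrow> 'd point) \<Rightarrow> real" where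
  "graph_value \<delta> m0 f \<mu> \<G> x = forest_mult (fst \<G>) *
     (LINT u|forest_measure \<delta> (fst \<G>). graph_integrand \<delta> m0 f \<mu> \<G> x u)"

section \<open>Convergence of the integrals and expectations of products of trees\<close>

definition tree_integrals_converge ::
    "real \<Rightarrow> real \<Rightarrow> nat \<Rightarrow> (real ^ 'd::finite \<Rightarrow> real) \<Rightarrow> ('d point \<Rightarrow> real) \<Rightarrow> bool" where
  "tree_integrals_converge \<delta> m0 p f g \<longleftrightarrow> (\<forall>j. \<forall>T\<in>trees p j. \<forall>x\<in>Gam \<delta>.
     integrable (forest_measure \<delta> [T]) (tree_integrand \<delta> m0 f g T x))"

text \<open>The first part says that the inner integrals, over the positions of leaves of type one, exist;
  the second that the remaining integral converges.\<close>

definition graph_integrals_converge :: "real \<Rightarrow> real \<Rightarrow> nat \<Rightarrow> (real ^ 'd::finite \<Rightarrow> real) \<Rightarrow>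
    (nat \<Rightarrow> ((nat \<Rightarrow> 'd point) \<Rightarrow> real) set) \<Rightarrow> (nat \<Rightarrow> ((nat \<Rightarrow> 'd point) \<Rightarrow> real) \<Rightarrow> real) \<Rightarrow> bool" where
  "graph_integrals_converge \<delta> m0 p f D \<mu> \<longleftrightarrow>
     (\<forall>m n. \<forall>\<G>\<in>PW_graphs p m n. \<forall>x. (\<forall>i<n. x i \<in> Gam \<delta>) \<longrightarrow>
        (\<forall>J\<subseteq>set (leaves1 (fst \<G>)). AE u in forest_measure \<delta> (fst \<G>).
           tensor (leaf_functions \<delta> m0 x (fst u) (filter (\<lambda>v. v \<in> J) (leaves1 (fst \<G>)))) \<in> D (card J)) \<and>
        integrable (forest_measure \<delta> (fst \<G>)) (graph_integrand \<delta> m0 f \<mu> \<G> x))"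

text \<open>The expectation of a product of tree values exists and is computed by replacing the product of
  the factors \<open>\<eta> (z)\<close> under the integral by the moment function. \<open>Y \<omega>\<close> is the realisation of
  \<open>G * \<eta>\<close>.\<close>

definition tree_expectations_by_moments :: "'w measure \<Rightarrow> real \<Rightarrow> real \<Rightarrow> nat \<Rightarrow>
    (real ^ 'd::finite \<Rightarrow> real) \<Rightarrow> ('w \<Rightarrow> 'd point \<Rightarrow> real) \<Rightarrow>
    (nat \<Rightarrow> ((nat \<Rightarrow> 'd point) \<Rightarrow> real) \<Rightarrow> real) \<Rightarrow> bool" where
  "tree_expectations_by_moments M \<delta> m0 p f Y \<mu> \<longleftrightarrow>
     (\<forall>Ts x. (\<forall>T\<in>set Ts. \<exists>j. T \<in> trees p j) \<and> (\<forall>i<length Ts. x i \<in> Gam \<delta>) \<longrightarrow>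
        integrable M (\<lambda>\<omega>. \<Prod>i<length Ts. tree_value \<delta> m0 f (Y \<omega>) (Ts ! i) (x i)) \<and>
        (LINT \<omega>|M. (\<Prod>i<length Ts. tree_value \<delta> m0 f (Y \<omega>) (Ts ! i) (x i))) =
        forest_mult Ts * (LINT u|forest_measure \<delta> Ts. forest_kernel \<delta> m0 f Ts x u *
          moment \<mu> (leaf_functions \<delta> m0 x (fst u) (leaves1 Ts))))"

end

theory Submission
  imports Defs
begin

text \<open>Each coefficient \<open>X\<^sub>j\<close> is the sum of the values of the trees in \<open>\<A>(j)\<close>. Inductively, the
  products \<open>\<Prod> X\<^sub>i ^ n\<^sub>i\<close> with their multinomial coefficients expand into a sum over all words of
  attached trees; the words with a given multiset of ranks are the rearrangements of one sorted
  word, and there are \<open>M(v)\<close> of them. Fubini's theorem merges the convolution with \<open>G\<close>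
  and the integrals of the attached trees into the integral of the larger tree. Multiplying out,
  the expectation of a product of tree values is given by a full moment function of the noise, and
  expanding it over the partitions of the leaves of type one gives the graphs.\<close>

section \<open>Words, multisets and multinomial coefficients\<close>

text \<open>The recursion for \<open>X_coeff\<close> counts attached leaves of both types together
  in n_0, whereas M(v) separates n_0' from n_0 - n_0'. Hence one sum over unsorted lists of trees is
  grouped twice, by \<open>num_inner\<close> and by the finer \<open>tree_rank\<close>. Only the
  words of ranks are sorted; trees of equal rank may differ and keep their order, in agreement with
  the convention that different lists give different trees.

  A vertex is named by its address, so its name changes when a tree is cut or put next to others.
  Fubini's theorem therefore comes with a change of variables between product measures over
  different index sets, along an injection of addresses.

  The Bochner integral of a non-integrable function is 0, so no exchange of sum and integral is
  automatic: each one rests on the convergence of individual tree or graph integrals. The sums in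
  each order of \<lambda> are finite because each set of trees with j inner vertices is finite.
  Moments are truncated at fixed positions of the inner vertices, where every block contributes a
  number, so this step is a finite identity under the integral sign.\<close>

lemma sum_prod_list_by_key:
  fixes V :: "'a \<Rightarrow> 'b::comm_semiring_1"
  shows "(\<Sum>ts | set ts \<subseteq> A \<and> map \<kappa> ts = c. \<Prod>t\<leftarrow>ts. V t) = (\<Prod>r\<leftarrow>c. \<Sum>t | t \<in> A \<and> \<kappa> t = r. V t)"
proof (induction c)
  case Nil
  have "{ts. set ts \<subseteq> A \<and> map \<kappa> ts = []} = {[]}" by auto
  then show ?case by simp
next
  case (Cons r c)
  let ?X = "{t. t \<in> A \<and> \<kappa> t = r}" and ?Y = "{ts. set ts \<subseteq> A \<and> map \<kappa> ts = c}"
  have "{ts. set ts \<subseteq> A \<and> map \<kappa> ts = r # c} = (\<lambda>(t, ts). t # ts) ` (?X \<times> ?Y)"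
    by (auto simp: map_eq_Cons_conv image_iff)
  moreover have "inj_on (\<lambda>(t, ts). t # ts) (?X \<times> ?Y)"
    by (auto simp: inj_on_def)
  ultimately have "(\<Sum>ts | set ts \<subseteq> A \<and> map \<kappa> ts = r # c. \<Prod>t\<leftarrow>ts. V t) =
      (\<Sum>(t, ts)\<in>?X \<times> ?Y. V t * (\<Prod>t\<leftarrow>ts. V t))"
    by (intro sum.reindex_cong[where l = "\<lambda>(t, ts). t # ts"]) auto
  also have "\<dots> = (\<Sum>t\<in>?X. V t) * (\<Sum>ts\<in>?Y. \<Prod>t\<leftarrow>ts. V t)"
    by (simp add: sum.cartesian_product[symmetric] sum_product)
  finally show ?case by (simp add: Cons.IH)
qed

lemma card_permutations_real:
  "real (card (permutations_of_multiset A)) =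
    fact (size A) / (\<Prod>x\<in>set_mset A. fact (count A x))"
proof -
  have "real (card (permutations_of_multiset A) * (\<Prod>x\<in>set_mset A. fact (count A x))) =
      real (fact (size A))"
    by (simp only: card_permutations_of_multiset_aux)
  then show ?thesis
    by (simp add: field_simps)
qed

text \<open>Closure under rearrangement makes each fibre of \<open>mset\<close> the full set of
  permutations of a multiset, and the coefficient is the size of that set.\<close>

lemma sum_lists_by_mset:
  fixes h :: "'a multiset \<Rightarrow> real"
  assumes "finite C" and perm: "\<And>xs ys. xs \<in> C \<Longrightarrow> mset xs = mset ys \<Longrightarrow> ys \<in> C"
  shows "(\<Sum>xs\<in>C. h (mset xs)) =
    (\<Sum>A\<in>mset ` C. fact (size A) / (\<Prod>x\<in>set_mset A. fact (count A x)) * h A)"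
proof -
  have "(\<Sum>xs\<in>C. h (mset xs)) = (\<Sum>A\<in>mset ` C. \<Sum>xs\<in>{xs \<in> C. mset xs = A}. h (mset xs))"
    by (rule sum.image_gen) fact
  also have "\<dots> = (\<Sum>A\<in>mset ` C. real (card (permutations_of_multiset A)) * h A)"
  proof (rule sum.cong[OF refl])
    fix A assume "A \<in> mset ` C"
    then have "{xs \<in> C. mset xs = A} = permutations_of_multiset A"
      by (auto simp: permutations_of_multiset_def intro: perm)
    then show "(\<Sum>xs\<in>{xs \<in> C. mset xs = A}. h (mset xs)) =
        real (card (permutations_of_multiset A)) * h A"
      by (simp add: permutations_of_multiset_def)
  qed
  finally show ?thesis by (simp add: card_permutations_real)
qed

text \<open>Each multiset has exactly one sorted word. This form matches the encoding of trees,
  whose children are listed by increasing rank.\<close>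

lemma sum_lists_by_sorted:
  fixes h :: "'a::linorder multiset \<Rightarrow> real"
  assumes "finite C" and perm: "\<And>xs ys. xs \<in> C \<Longrightarrow> mset xs = mset ys \<Longrightarrow> ys \<in> C"
  shows "(\<Sum>xs\<in>C. h (mset xs)) =
    (\<Sum>xs | xs \<in> C \<and> sorted xs.
      fact (length xs) / (\<Prod>x\<in>set xs. fact (count_list xs x)) * h (mset xs))"
proof -
  have "bij_betw mset {xs \<in> C. sorted xs} (mset ` C)"
  proof (rule bij_betwI')
    fix xs ys :: "'a list" assume "xs \<in> {xs \<in> C. sorted xs}" "ys \<in> {xs \<in> C. sorted xs}"
    then show "(mset xs = mset ys) = (xs = ys)"
      by (auto dest: properties_for_sort)
         (metis properties_for_sort)
  next
    fix A assume "A \<in> mset ` C"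
    then obtain xs where "xs \<in> C" "A = mset xs" by auto
    then show "\<exists>ys\<in>{xs \<in> C. sorted xs}. A = mset ys"
      by (intro bexI[of _ "sort xs"]) (auto intro: perm)
  qed auto
  then show ?thesis
    by (simp add: sum_lists_by_mset[OF assms] count_mset flip: sum.reindex_bij_betw)
qed

text \<open>This is the multinomial theorem graded by weight: an exponent vector is the count
  function of a word w, the two conditions on it fix the length and the sum of w, and the
  coefficient is the number of such words.\<close>

lemma multinomial_exponents:
  fixes a :: "nat \<Rightarrow> real"
  shows "(\<Sum>n\<in>exponents p j. fact p / (\<Prod>i\<le>j. fact (n i)) * (\<Prod>i\<le>j. a i ^ n i)) =
    (\<Sum>w | length w = p \<and> sum_list w = j. \<Prod>i\<leftarrow>w. a i)"
proof -
  let ?C = "{w. length w = p \<and> sum_list w = j}"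
  have le: "i \<le> j" if "sum_list w = j" "i \<in> set w" for w i
    using that by (auto intro: member_le_sum_list)
  have "?C \<subseteq> {w. set w \<subseteq> {..j} \<and> length w = p}"
    using le by auto
  then have fin: "finite ?C"
    by (rule finite_subset) (intro finite_lists_length_eq finite_atMost)
  have "bij_betw count (mset ` ?C) (exponents p j)"
  proof (rule bij_betw_imageI)
    show "inj_on count (mset ` ?C)" by (simp add: inj_on_def multiset_eq_iff)
    show "count ` mset ` ?C = exponents p j"
    proof (intro subset_antisym subsetI)
      fix n assume "n \<in> count ` mset ` ?C"
      then obtain w where w: "n = count_list w" "length w = p" "sum_list w = j"
        by (auto simp: count_mset[abs_def])
      have sub: "set w \<subseteq> {..j}" using w le by auto
      have "(\<Sum>i\<le>j. count_list w i) = length w"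
        using sub by (simp add: sum_count_set)
      moreover have "sum_list (map id w) = (\<Sum>i\<in>set w. count_list w i * id i)"
        by (rule sum_list_map_eq_sum_count)
      moreover have "\<dots> = (\<Sum>i\<le>j. i * count_list w i)"
        using sub by (intro sum.mono_neutral_cong_left) (auto simp: count_list_0_iff)
      ultimately show "n \<in> exponents p j"
        using w sub by (auto simp: exponents_def count_list_0_iff)
    next
      fix n assume n: "n \<in> exponents p j"
      then have le_j: "i \<le> j" if "n i \<noteq> 0" for i
        using that by (auto simp: exponents_def not_less[symmetric])
      then have "{i. n i > 0} \<subseteq> {..j}" by auto
      then have "finite {i. n i > 0}" by (rule finite_subset) simp
      \<comment> \<open>\<open>Abs_multiset\<close> is inverted by \<open>count\<close> only on
        functions of finite support; here the support lies in \<open>{..j}\<close>.\<close>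
      then have cnt: "count (Abs_multiset n) = n" by simp
      obtain w where w: "mset w = Abs_multiset n" by (metis ex_mset)
      then have nw: "n = count_list w" using cnt by (metis count_mset ext)
      then have sub: "set w \<subseteq> {..j}"
        using le_j by (auto simp: count_list_0_iff)
      have "(\<Sum>i\<le>j. count_list w i) = length w"
        using sub by (simp add: sum_count_set)
      moreover have "sum_list (map id w) = (\<Sum>i\<in>set w. count_list w i * id i)"
        by (rule sum_list_map_eq_sum_count)
      moreover have "\<dots> = (\<Sum>i\<le>j. i * count_list w i)"
        using sub by (intro sum.mono_neutral_cong_left) (auto simp: count_list_0_iff)
      ultimately have "w \<in> ?C" using n nw by (auto simp: exponents_def)
      then show "n \<in> count ` mset ` ?C"
        using w cnt by (intro image_eqI[of n count "mset w"] imageI) simp_all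
    qed
  qed
  then have "(\<Sum>n\<in>exponents p j. fact p / (\<Prod>i\<le>j. fact (n i)) * (\<Prod>i\<le>j. a i ^ n i)) =
    (\<Sum>A\<in>mset ` ?C. fact p / (\<Prod>i\<le>j. fact (count A i)) * (\<Prod>i\<le>j. a i ^ count A i))"
    by (simp add: sum.reindex_bij_betw[symmetric])
  also have "\<dots> = (\<Sum>A\<in>mset ` ?C. fact (size A) / (\<Prod>x\<in>set_mset A. fact (count A x)) *
      prod_mset (image_mset a A))"
  proof (rule sum.cong[OF refl])
    fix A assume "A \<in> mset ` ?C"
    then have sub: "set_mset A \<subseteq> {..j}" and "size A = p" using le by auto
    have "(\<Prod>i\<le>j. fact (count A i) :: real) = (\<Prod>x\<in>set_mset A. fact (count A x))"
      using sub by (intro prod.mono_neutral_right) (auto simp: not_in_iff)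
    moreover have "(\<Prod>i\<le>j. a i ^ count A i) = (\<Prod>x\<in>set_mset A. a x ^ count A x)"
      using sub by (intro prod.mono_neutral_right) (auto simp: not_in_iff)
    ultimately show "fact p / (\<Prod>i\<le>j. fact (count A i)) * (\<Prod>i\<le>j. a i ^ count A i) =
        fact (size A) / (\<Prod>x\<in>set_mset A. fact (count A x)) * prod_mset (image_mset a A)"
      using \<open>size A = p\<close> by (simp add: image_prod_mset_multiplicity)
  qed
  also have "\<dots> = (\<Sum>w\<in>?C. prod_mset (image_mset a (mset w)))"
    by (rule sum_lists_by_mset[symmetric, OF fin]) (auto dest: mset_eq_length simp flip: sum_mset_sum_list)
  finally show ?thesis by (simp add: prod_mset_prod_list flip: mset_map)
qed

section \<open>Lists of trees with a given total number of inner vertices\<close>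

definition tree_lists :: "nat \<Rightarrow> nat \<Rightarrow> nat \<Rightarrow> pw_tree list set" where
  "tree_lists p n j = {ts. length ts = n \<and> set ts \<subseteq> Collect (well_formed p) \<and>
     sum_list (map num_inner ts) = j}"

lemma trees_0: "trees p 0 = {Leaf1, Leaf2}"
proof -
  have "T \<in> trees p 0 \<longleftrightarrow> T \<in> {Leaf1, Leaf2}" for T
    by (cases T) (auto simp: trees_def)
  then show ?thesis by blast
qed

lemma trees_Suc:
  "trees p (Suc j) = Inner ` {ts \<in> tree_lists p p j. sorted (map tree_rank ts)}"
proof -
  have "T \<in> trees p (Suc j) \<longleftrightarrow> T \<in> Inner ` {ts \<in> tree_lists p p j. sorted (map tree_rank ts)}" for T
    by (cases T) (auto simp: trees_def tree_lists_def)
  then show ?thesis by blast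
qed

text \<open>Each member of a list of weight j has at most j inner vertices. The conditional form
  breaks the circle with \<open>finite_trees\<close>, where trees with j + 1 inner vertices arise
  from lists of weight j.\<close>

lemma finite_tree_lists_of_trees:
  assumes "\<And>i. i \<le> j \<Longrightarrow> finite (trees p i)"
  shows "finite (tree_lists p n j)"
proof (rule finite_subset)
  show "tree_lists p n j \<subseteq> {ts. set ts \<subseteq> (\<Union>i\<le>j. trees p i) \<and> length ts = n}"
    by (auto simp: tree_lists_def trees_def intro!: member_le_sum_list)
  show "finite {ts. set ts \<subseteq> (\<Union>i\<le>j. trees p i) \<and> length ts = n}"
    using assms by (intro finite_lists_length_eq) auto
qed

lemma finite_trees: "finite (trees p j)"
proof (induction j rule: less_induct)
  case (less j)
  show ?case
  proof (cases j)
    case (Suc i)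
    then have "finite (tree_lists p p i)"
      using less by (intro finite_tree_lists_of_trees) auto
    then show ?thesis by (simp add: Suc trees_Suc)
  qed (simp add: trees_0)
qed

lemma finite_tree_lists: "finite (tree_lists p n j)"
  by (intro finite_tree_lists_of_trees finite_trees)

text \<open>Truncated subtraction sends the ranks 0 and 1 of the two leaf types both to 0. Thus the
  word of ranks determines the word of numbers of inner vertices and refines it exactly by the type
  of the leaves.\<close>

lemma num_inner_eq_rank: "num_inner t = tree_rank t - 1"
  by (cases t) (simp_all add: tree_rank_def)

text \<open>Both sides equal the sum of the products over all lists in
  \<open>tree_lists p p j\<close>. Grouping by \<open>num_inner\<close> gives the coefficients of
  the recursion for X, grouping by \<open>tree_rank\<close> gives the vertex multiplicities.\<close>

lemma multinomial_trees:
  fixes V :: "pw_tree \<Rightarrow> real"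
  shows "(\<Sum>n\<in>exponents p j. fact p / (\<Prod>i\<le>j. fact (n i)) *
        (\<Prod>i\<le>j. (\<Sum>T\<in>trees p i. V T) ^ n i)) =
    (\<Sum>ts | ts \<in> tree_lists p p j \<and> sorted (map tree_rank ts).
        vertex_mult (Inner ts) * (\<Prod>t\<leftarrow>ts. V t))"
proof -
  let ?WF = "Collect (well_formed p)" and ?N = "tree_lists p p j"
  let ?P = "\<lambda>ts. \<Prod>t\<leftarrow>ts. V t"
  define W where "W r = (\<Sum>t | t \<in> ?WF \<and> tree_rank t = r. V t)" for r
  define C where "C = map tree_rank ` ?N"
  \<comment> \<open>A rank word from \<open>C\<close> already fixes the length and the weight, so
    membership in \<open>?N\<close> reduces to well-formedness of the entries and the distributive
    law applies to each fibre.\<close>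
  have fib: "{ts \<in> ?N. map tree_rank ts = c} = {ts. set ts \<subseteq> ?WF \<and> map tree_rank ts = c}"
    if c: "c \<in> C" for c
  proof -
    obtain us where us: "us \<in> ?N" "c = map tree_rank us"
      using c by (auto simp: C_def)
    have key: "sum_list (map num_inner ts) = sum_list (map num_inner us)"
      if eq: "map tree_rank ts = map tree_rank us" for ts
    proof -
      have "map (\<lambda>r. r - 1) (map tree_rank ts) = map (\<lambda>r. r - 1) (map tree_rank us)"
        by (simp only: eq)
      then show ?thesis by (simp add: num_inner_eq_rank[abs_def] comp_def)
    qed
    have "ts \<in> ?N" if "set ts \<subseteq> ?WF" "map tree_rank ts = c" for ts
      using that us key[of ts] map_eq_imp_length_eq[of tree_rank ts tree_rank us]
      by (simp add: tree_lists_def)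
    moreover have "?N \<subseteq> {ts. set ts \<subseteq> ?WF}" by (auto simp: tree_lists_def)
    ultimately show ?thesis by blast
  qed
  \<comment> \<open>This description depends only on the multiset of letters, which shows that
    \<open>C\<close> is closed under rearrangement.\<close>
  have C_eq: "C = {c. length c = p \<and> sum_list (map (\<lambda>r. r - 1) c) = j \<and> set c \<subseteq> tree_rank ` ?WF}"
  proof (intro subset_antisym subsetI)
    fix c assume "c \<in> {c. length c = p \<and> sum_list (map (\<lambda>r. r - 1) c) = j \<and> set c \<subseteq> tree_rank ` ?WF}"
    then have c: "length c = p" "sum_list (map (\<lambda>r. r - 1) c) = j" "c \<in> lists (tree_rank ` ?WF)"
      by auto
    then obtain ts where "ts \<in> lists ?WF" "c = map tree_rank ts"
      unfolding lists_image by auto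
    then show "c \<in> C"
      using c by (auto simp: C_def tree_lists_def num_inner_eq_rank[abs_def] comp_def intro!: imageI)
  qed (auto simp: C_def tree_lists_def num_inner_eq_rank[abs_def] comp_def, blast)
  have finC: "finite C"
    by (simp add: C_def finite_tree_lists)
  have finW: "finite {w. length w = p \<and> sum_list w = j}"
  proof (rule finite_subset)
    show "{w. length w = p \<and> sum_list w = j} \<subseteq> {w. set w \<subseteq> {..j} \<and> length w = p}"
      using member_le_sum_list by fastforce
  qed (intro finite_lists_length_eq finite_atMost)
  have "(\<Sum>n\<in>exponents p j. fact p / (\<Prod>i\<le>j. fact (n i)) *
        (\<Prod>i\<le>j. (\<Sum>T\<in>trees p i. V T) ^ n i)) =
      (\<Sum>w | length w = p \<and> sum_list w = j. \<Prod>i\<leftarrow>w. \<Sum>T | T \<in> ?WF \<and> num_inner T = i. V T)"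
    by (simp only: multinomial_exponents trees_def mem_Collect_eq)
  also have "\<dots> = (\<Sum>w | length w = p \<and> sum_list w = j.
      \<Sum>ts | set ts \<subseteq> ?WF \<and> map num_inner ts = w. ?P ts)"
    by (simp only: sum_prod_list_by_key)
  also have "\<dots> = (\<Sum>w | length w = p \<and> sum_list w = j.
      \<Sum>ts | ts \<in> ?N \<and> map num_inner ts = w. ?P ts)"
    by (intro sum.cong refl) (auto simp: tree_lists_def)
  also have "\<dots> = (\<Sum>ts\<in>?N. ?P ts)"
    by (rule sum.group[OF finite_tree_lists finW]) (auto simp: tree_lists_def)
  \<comment> \<open>The grouping by number of inner vertices has been undone; from here the same sum
    is grouped by rank.\<close>
  also have "\<dots> = (\<Sum>c\<in>C. \<Sum>ts | ts \<in> ?N \<and> map tree_rank ts = c. ?P ts)"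
    unfolding C_def by (rule sum.image_gen) (rule finite_tree_lists)
  also have "\<dots> = (\<Sum>c\<in>C. \<Prod>r\<leftarrow>c. W r)"
    by (intro sum.cong refl) (simp only: fib sum_prod_list_by_key W_def)
  also have "\<dots> = (\<Sum>c\<in>C. prod_mset (image_mset W (mset c)))"
    by (simp add: prod_mset_prod_list flip: mset_map)
  also have "\<dots> = (\<Sum>c | c \<in> C \<and> sorted c.
      fact (length c) / (\<Prod>r\<in>set c. fact (count_list c r)) * prod_mset (image_mset W (mset c)))"
  proof (rule sum_lists_by_sorted[OF finC])
    fix xs ys :: "nat list" assume xs: "xs \<in> C" and eq: "mset xs = mset ys"
    have "sum_list (map (\<lambda>r. r - 1) xs) = sum_list (map (\<lambda>r. r - 1) ys)"
      by (metis eq mset_map sum_mset_sum_list)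
    then show "ys \<in> C"
      using xs mset_eq_length[OF eq] mset_eq_setD[OF eq] by (auto simp: C_eq)
  qed
  also have "\<dots> = (\<Sum>c | c \<in> C \<and> sorted c.
      fact (length c) / (\<Prod>r\<in>set c. fact (count_list c r)) * (\<Prod>r\<leftarrow>c. W r))"
    by (simp add: prod_mset_prod_list flip: mset_map)
  \<comment> \<open>The multinomial coefficient of the rank word is the vertex multiplicity, which
    is constant on the fibre and so can be moved under the inner sum.\<close>
  also have "\<dots> = (\<Sum>c | c \<in> C \<and> sorted c. \<Sum>ts | ts \<in> ?N \<and> map tree_rank ts = c.
      vertex_mult (Inner ts) * ?P ts)"
  proof (rule sum.cong[OF refl], clarify)
    fix c assume c: "c \<in> C"
    have "(\<Prod>r\<leftarrow>c. W r) = (\<Sum>ts | ts \<in> ?N \<and> map tree_rank ts = c. ?P ts)"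
      by (simp only: fib[OF c] sum_prod_list_by_key W_def)
    then show "fact (length c) / (\<Prod>r\<in>set c. fact (count_list c r)) * (\<Prod>r\<leftarrow>c. W r) =
        (\<Sum>ts | ts \<in> ?N \<and> map tree_rank ts = c. vertex_mult (Inner ts) * ?P ts)"
      by (auto simp: sum_distrib_left intro!: sum.cong)
  qed
  also have "\<dots> = (\<Sum>c | c \<in> C \<and> sorted c. \<Sum>ts | ts \<in> {ts \<in> ?N. sorted (map tree_rank ts)} \<and> map tree_rank ts = c.
      vertex_mult (Inner ts) * ?P ts)"
    by (intro sum.cong refl) auto
  also have "\<dots> = (\<Sum>ts | ts \<in> ?N \<and> sorted (map tree_rank ts). vertex_mult (Inner ts) * ?P ts)"
    by (rule sum.group) (auto simp: finite_tree_lists finC C_def)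
  finally show ?thesis .
qed

section \<open>Splicing product measures\<close>

lemma space_lat_measure [simp]: "space (lat_measure \<delta>) = lat \<delta>"
  by (simp add: lat_measure_def)

lemma sets_lat_measure [simp]: "sets (lat_measure \<delta>) = Pow (lat \<delta>)"
  by (simp add: lat_measure_def)

lemma space_Gam_measure [simp]: "space (Gam_measure \<delta>) = Gam \<delta>"
  by (simp add: Gam_measure_def Gam_def space_pair_measure)

lemma countable_lat: "countable (lat \<delta> :: (real ^ 'd::finite) set)"
proof -
  have "v \<in> (\<lambda>k. \<chi> i. \<delta> * of_int (k i)) ` (UNIV :: ('d \<Rightarrow> int) set)" if v: "v \<in> lat \<delta>" for v
  proof -
    obtain k where "\<And>i. v $ i = \<delta> * of_int (k i)"
      using v by (auto simp: lat_def) metis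
    then show ?thesis by (intro image_eqI[of _ _ k]) (simp_all add: vec_eq_iff)
  qed
  moreover have "countable (UNIV :: ('d \<Rightarrow> int) set)"
    by (rule countableI_type)
  ultimately show ?thesis
    by (meson countable_image countable_subset subsetI)
qed

lemma sigma_finite_lat: "sigma_finite_measure (lat_measure \<delta> :: (real ^ 'd::finite) measure)"
proof -
  interpret sigma_finite_measure "count_space (lat \<delta> :: (real ^ 'd) set)"
    by (rule sigma_finite_measure_count_space_countable) (rule countable_lat)
  show ?thesis
    unfolding lat_measure_def by (subst sigma_finite_iff_density_finite) auto
qed

lemma sigma_finite_Gam: "sigma_finite_measure (Gam_measure \<delta> :: 'd::finite point measure)"
proof -
  interpret sigma_finite_measure "lat_measure \<delta> :: (real ^ 'd) measure"
    by (rule sigma_finite_lat)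
  interpret pair_sigma_finite "lborel :: real measure" "lat_measure \<delta> :: (real ^ 'd) measure" ..
  show ?thesis
    unfolding Gam_measure_def by (rule P.sigma_finite_measure_axioms)
qed

text \<open>Positions come as pairs (inner vertices, leaves of type two). Joining two such pairs
  componentwise requires the two middle factors to change places, which is Tonelli's theorem for
  indicator functions.\<close>

lemma pair_measure_middle_swap:
  assumes "sigma_finite_measure M1" "sigma_finite_measure M2"
    and "sigma_finite_measure N1" "sigma_finite_measure N2"
  shows "distr ((M1 \<Otimes>\<^sub>M N1) \<Otimes>\<^sub>M (M2 \<Otimes>\<^sub>M N2)) ((M1 \<Otimes>\<^sub>M M2) \<Otimes>\<^sub>M (N1 \<Otimes>\<^sub>M N2))
      (\<lambda>z. ((fst (fst z), fst (snd z)), (snd (fst z), snd (snd z)))) = (M1 \<Otimes>\<^sub>M M2) \<Otimes>\<^sub>M (N1 \<Otimes>\<^sub>M N2)"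
    (is "distr ?A ?B ?f = _")
proof (rule measure_eqI)
  interpret M1: sigma_finite_measure M1 by fact
  interpret M2: sigma_finite_measure M2 by fact
  interpret N1: sigma_finite_measure N1 by fact
  interpret N2: sigma_finite_measure N2 by fact
  interpret NN: pair_sigma_finite N1 N2 ..
  interpret MN2: pair_sigma_finite M2 N2 ..
  interpret X: pair_sigma_finite N1 M2 ..
  have f: "?f \<in> measurable ?A ?B" by measurable
  fix E assume "E \<in> sets (distr ?A ?B ?f)"
  then have E[measurable]: "E \<in> sets ?B" by simp
  have "emeasure (distr ?A ?B ?f) E = (\<integral>\<^sup>+z. indicator E z \<partial>distr ?A ?B ?f)"
    using E by (intro nn_integral_indicator[symmetric]) simp
  also have "\<dots> = (\<integral>\<^sup>+z. indicator E (?f z) \<partial>?A)"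
    using E by (intro nn_integral_distr f) simp
  also have "\<dots> = (\<integral>\<^sup>+u. \<integral>\<^sup>+v. indicator E (?f (u, v)) \<partial>(M2 \<Otimes>\<^sub>M N2) \<partial>(M1 \<Otimes>\<^sub>M N1))"
    by (rule MN2.P.nn_integral_fst[symmetric]) measurable
  also have "\<dots> = (\<integral>\<^sup>+a. \<integral>\<^sup>+b. \<integral>\<^sup>+v. indicator E (?f ((a, b), v)) \<partial>(M2 \<Otimes>\<^sub>M N2) \<partial>N1 \<partial>M1)"
    by (rule N1.nn_integral_fst[symmetric]) measurable
  also have "\<dots> = (\<integral>\<^sup>+a. \<integral>\<^sup>+b. \<integral>\<^sup>+c. \<integral>\<^sup>+d. indicator E (?f ((a, b), (c, d))) \<partial>N2 \<partial>M2 \<partial>N1 \<partial>M1)"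
    by (intro nn_integral_cong N2.nn_integral_fst[symmetric]) measurable
  also have "\<dots> = (\<integral>\<^sup>+a. \<integral>\<^sup>+b. \<integral>\<^sup>+c. \<integral>\<^sup>+d. indicator E ((a, c), (b, d)) \<partial>N2 \<partial>M2 \<partial>N1 \<partial>M1)"
    by (simp only: fst_conv snd_conv)
  \<comment> \<open>This is the only exchange in the order of integration; the other steps pass
    between iterated and product integrals.\<close>
  also have "\<dots> = (\<integral>\<^sup>+a. \<integral>\<^sup>+c. \<integral>\<^sup>+b. \<integral>\<^sup>+d. indicator E ((a, c), (b, d)) \<partial>N2 \<partial>N1 \<partial>M2 \<partial>M1)"
    by (intro nn_integral_cong X.Fubini'[symmetric]) measurable
  also have "\<dots> = (\<integral>\<^sup>+a. \<integral>\<^sup>+c. \<integral>\<^sup>+v. indicator E ((a, c), v) \<partial>(N1 \<Otimes>\<^sub>M N2) \<partial>M2 \<partial>M1)"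
    by (intro nn_integral_cong N2.nn_integral_fst) measurable
  also have "\<dots> = (\<integral>\<^sup>+u. \<integral>\<^sup>+v. indicator E (u, v) \<partial>(N1 \<Otimes>\<^sub>M N2) \<partial>(M1 \<Otimes>\<^sub>M M2))"
    by (rule M2.nn_integral_fst) measurable
  also have "\<dots> = (\<integral>\<^sup>+z. indicator E z \<partial>?B)"
    by (rule NN.P.nn_integral_fst) measurable
  finally show "emeasure (distr ?A ?B ?f) E = emeasure ?B E" by simp
qed simp

text \<open>The second family is transported along the injection \<open>h\<close>; this is how the vertices of a subtree
  become vertices of the tree containing it.\<close>

definition splice_family :: "'i set \<Rightarrow> 'j set \<Rightarrow> ('j \<Rightarrow> 'i) \<Rightarrow> ('i \<Rightarrow> 'a) \<times> ('j \<Rightarrow> 'a) \<Rightarrow> 'i \<Rightarrow> 'a" where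
  "splice_family A B h u = (\<lambda>i\<in>A \<union> h ` B. if i \<in> A then fst u i else snd u (inv_into B h i))"

lemma splice_family_left: "i \<in> A \<Longrightarrow> splice_family A B h u i = fst u i"
  by (simp add: splice_family_def)

lemma splice_family_right:
  "inj_on h B \<Longrightarrow> A \<inter> h ` B = {} \<Longrightarrow> i \<in> B \<Longrightarrow> splice_family A B h u (h i) = snd u i"
  by (auto simp: splice_family_def)

lemma measurable_splice_family:
  assumes "inj_on h B"
  shows "splice_family A B h \<in> measurable (PiM A (\<lambda>_. M) \<Otimes>\<^sub>M PiM B (\<lambda>_. M)) (PiM (A \<union> h ` B) (\<lambda>_. M))"
  unfolding splice_family_def
proof (rule measurable_restrict)
  fix i assume i: "i \<in> A \<union> h ` B"
  show "(\<lambda>u. if i \<in> A then fst u i else snd u (inv_into B h i))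
      \<in> measurable (PiM A (\<lambda>_. M) \<Otimes>\<^sub>M PiM B (\<lambda>_. M)) M"
  proof (cases "i \<in> A")
    case False
    then have "inv_into B h i \<in> B" using i by (simp add: inv_into_into)
    then show ?thesis using False by simp
  qed simp
qed

text \<open>A finite product of sigma-finite measures is determined by its values on boxes. The
  preimage of a box is a product of two boxes, and injectivity of \<open>h\<close> with disjointness
  keeps every coordinate from being counted twice.\<close>

lemma distr_splice_family:
  assumes "sigma_finite_measure M" and fin: "finite A" "finite B"
    and inj: "inj_on h B" and disj: "A \<inter> h ` B = {}"
  shows "distr (PiM A (\<lambda>_. M) \<Otimes>\<^sub>M PiM B (\<lambda>_. M)) (PiM (A \<union> h ` B) (\<lambda>_. M)) (splice_family A B h) =
    PiM (A \<union> h ` B) (\<lambda>_. M)" (is "distr ?P ?Q _ = _")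
proof -
  interpret M: sigma_finite_measure M by fact
  interpret product_sigma_finite "\<lambda>_. M" ..
  interpret B: finite_product_sigma_finite "\<lambda>_. M" B by standard fact
  show ?thesis
  proof (rule PiM_eqI)
    show "finite (A \<union> h ` B)" using fin by simp
    fix E assume E: "\<And>i. i \<in> A \<union> h ` B \<Longrightarrow> E i \<in> sets M"
    have "splice_family A B h -` (Pi\<^sub>E (A \<union> h ` B) E) \<inter> space ?P =
        (Pi\<^sub>E A E) \<times> (Pi\<^sub>E B (\<lambda>i. E (h i)))"
    proof (rule set_eqI, rule iffI)
      fix u assume u: "u \<in> splice_family A B h -` (Pi\<^sub>E (A \<union> h ` B) E) \<inter> space ?P"
      then have E: "splice_family A B h u i \<in> E i" if "i \<in> A \<union> h ` B" for i
        using that by (blast dest: PiE_mem)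
      have "fst u i \<in> E i" if "i \<in> A" for i
        using E[of i] that by (simp add: splice_family_left)
      moreover have "snd u i \<in> E (h i)" if "i \<in> B" for i
        using E[of "h i"] that by (simp add: splice_family_right[OF inj disj])
      ultimately show "u \<in> (Pi\<^sub>E A E) \<times> (Pi\<^sub>E B (\<lambda>i. E (h i)))"
        using u by (cases u) (auto simp: space_pair_measure space_PiM PiE_iff)
    next
      fix u assume u: "u \<in> (Pi\<^sub>E A E) \<times> (Pi\<^sub>E B (\<lambda>i. E (h i)))"
      have "splice_family A B h u i \<in> E i" if "i \<in> A" for i
        using u that by (auto simp: splice_family_left mem_Times_iff dest: PiE_mem)
      moreover have "splice_family A B h u (h i) \<in> E (h i)" if "i \<in> B" for i
      proof -
        have "snd u \<in> (\<Pi>\<^sub>E i\<in>B. E (h i))" using u by (simp add: mem_Times_iff)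
        then show ?thesis using that by (auto simp: splice_family_right[OF inj disj that] dest: PiE_mem)
      qed
      moreover have "splice_family A B h u \<in> extensional (A \<union> h ` B)"
        by (simp add: splice_family_def)
      ultimately have "splice_family A B h u \<in> Pi\<^sub>E (A \<union> h ` B) E"
        by (auto simp: PiE_iff)
      moreover have "u \<in> space ?P"
      proof -
        have "Pi\<^sub>E A E \<subseteq> Pi\<^sub>E A (\<lambda>_. space M)" "(\<Pi>\<^sub>E i\<in>B. E (h i)) \<subseteq> Pi\<^sub>E B (\<lambda>_. space M)"
          using E by (intro PiE_mono sets.sets_into_space; simp)+
        then show ?thesis using u by (auto simp: space_pair_measure space_PiM)
      qed
      ultimately show "u \<in> splice_family A B h -` (Pi\<^sub>E (A \<union> h ` B) E) \<inter> space ?P" by simp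
    qed
    moreover have "Pi\<^sub>E (A \<union> h ` B) E \<in> sets ?Q"
      using E fin by (intro sets_PiM_I_finite) auto
    ultimately have "emeasure (distr ?P ?Q (splice_family A B h)) (Pi\<^sub>E (A \<union> h ` B) E) =
        emeasure ?P ((Pi\<^sub>E A E) \<times> (Pi\<^sub>E B (\<lambda>i. E (h i))))"
      by (simp add: emeasure_distr measurable_splice_family[OF inj])
    also have "\<dots> = (\<Prod>i\<in>A. emeasure M (E i)) * (\<Prod>i\<in>B. emeasure M (E (h i)))"
      using E fin by (simp add: B.emeasure_pair_measure_Times sets_PiM_I_finite emeasure_PiM)
    also have "\<dots> = (\<Prod>i\<in>A \<union> h ` B. emeasure M (E i))"
      using fin disj inj by (simp add: prod.union_disjoint prod.reindex)
    finally show "emeasure (distr ?P ?Q (splice_family A B h)) (Pi\<^sub>E (A \<union> h ` B) E) =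
      (\<Prod>i\<in>A \<union> h ` B. emeasure M (E i))" .
  qed simp
qed

section \<open>Splicing the positions of inner vertices and of leaves of type two\<close>

definition vertex_measure ::
    "real \<Rightarrow> vertex set \<Rightarrow> vertex set \<Rightarrow> ((vertex \<Rightarrow> 'd::finite point) \<times> (vertex \<Rightarrow> real ^ 'd)) measure" where
  "vertex_measure \<delta> A A' = (\<Pi>\<^sub>M v\<in>A. Gam_measure \<delta>) \<Otimes>\<^sub>M (\<Pi>\<^sub>M v\<in>A'. lat_measure \<delta>)"

definition splice_positions :: "vertex set \<Rightarrow> vertex set \<Rightarrow> vertex set \<Rightarrow> vertex set \<Rightarrow> (vertex \<Rightarrow> vertex) \<Rightarrow>
    ((vertex \<Rightarrow> 'a) \<times> (vertex \<Rightarrow> 'b)) \<times> ((vertex \<Rightarrow> 'a) \<times> (vertex \<Rightarrow> 'b)) \<Rightarrow> (vertex \<Rightarrow> 'a) \<times> (vertex \<Rightarrow> 'b)" where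
  "splice_positions A A' B B' h =
    (\<lambda>((y, z), (y', z')). (splice_family A B h (y, y'), splice_family A' B' h (z, z')))"

lemma sigma_finite_PiM:
  "sigma_finite_measure M \<Longrightarrow> finite A \<Longrightarrow> sigma_finite_measure (PiM A (\<lambda>_. M))"
  by (rule product_sigma_finite.sigma_finite) (simp_all add: product_sigma_finite_def)

lemma sigma_finite_vertex_measure:
  assumes "finite A" "finite A'"
  shows "sigma_finite_measure (vertex_measure \<delta> A A' :: ((vertex \<Rightarrow> 'd::finite point) \<times> _) measure)"
proof -
  interpret G: sigma_finite_measure "PiM A (\<lambda>_. Gam_measure \<delta> :: 'd point measure)"
    by (intro sigma_finite_PiM sigma_finite_Gam assms)
  interpret L: sigma_finite_measure "PiM A' (\<lambda>_. lat_measure \<delta> :: (real ^ 'd) measure)"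
    by (intro sigma_finite_PiM sigma_finite_lat assms)
  interpret pair_sigma_finite "PiM A (\<lambda>_. Gam_measure \<delta> :: 'd point measure)"
    "PiM A' (\<lambda>_. lat_measure \<delta> :: (real ^ 'd) measure)" ..
  show ?thesis unfolding vertex_measure_def by (rule P.sigma_finite_measure_axioms)
qed

text \<open>The splicing map is a swap of the middle factors followed by one splice for the inner
  vertices and one for the leaves; each of these maps preserves the product measure.\<close>

lemma distr_splice_positions:
  fixes h :: "vertex \<Rightarrow> vertex"
  assumes fin: "finite A" "finite A'" "finite B" "finite B'"
    and inj: "inj h" and disj: "A \<inter> h ` B = {}" "A' \<inter> h ` B' = {}"
  shows "splice_positions A A' B B' h \<in>
      measurable (vertex_measure \<delta> A A' \<Otimes>\<^sub>M vertex_measure \<delta> B B' :: (_ \<times> (vertex \<Rightarrow> 'd::finite point) \<times> _) measure)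
        (vertex_measure \<delta> (A \<union> h ` B) (A' \<union> h ` B'))" (is ?meas)
    and "distr (vertex_measure \<delta> A A' \<Otimes>\<^sub>M vertex_measure \<delta> B B' :: (_ \<times> (vertex \<Rightarrow> 'd::finite point) \<times> _) measure)
        (vertex_measure \<delta> (A \<union> h ` B) (A' \<union> h ` B')) (splice_positions A A' B B' h) =
      vertex_measure \<delta> (A \<union> h ` B) (A' \<union> h ` B')" (is ?distr)
proof -
  let ?G = "\<lambda>A. PiM A (\<lambda>_. Gam_measure \<delta> :: 'd point measure)"
  let ?L = "\<lambda>A. PiM A (\<lambda>_. lat_measure \<delta> :: (real ^ 'd) measure)"
  let ?sw = "\<lambda>z. ((fst (fst z), fst (snd z)), (snd (fst z), snd (snd z)))"
  let ?sp = "\<lambda>(u, v). (splice_family A B h u, splice_family A' B' h v)"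
  have inj': "inj_on h C" for C using inj by (rule inj_on_subset) simp
  have sf: "sigma_finite_measure (?G C)" "sigma_finite_measure (?L C)" if "finite C" for C
    using that by (intro sigma_finite_PiM sigma_finite_Gam sigma_finite_lat; assumption)+
  have eq: "splice_positions A A' B B' h = ?sp \<circ> ?sw"
    by (simp add: fun_eq_iff splice_positions_def split_beta)
  have sw: "?sw \<in> measurable ((?G A \<Otimes>\<^sub>M ?L A') \<Otimes>\<^sub>M (?G B \<Otimes>\<^sub>M ?L B')) ((?G A \<Otimes>\<^sub>M ?G B) \<Otimes>\<^sub>M (?L A' \<Otimes>\<^sub>M ?L B'))"
    by measurable
  have sp: "?sp \<in> measurable ((?G A \<Otimes>\<^sub>M ?G B) \<Otimes>\<^sub>M (?L A' \<Otimes>\<^sub>M ?L B')) (?G (A \<union> h ` B) \<Otimes>\<^sub>M ?L (A' \<union> h ` B'))"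
    unfolding split_beta
    by (intro measurable_Pair measurable_compose[OF measurable_fst] measurable_compose[OF measurable_snd]
      measurable_splice_family inj')
  show ?meas
    unfolding vertex_measure_def eq by (rule measurable_comp[OF sw sp])
  note G = distr_splice_family[OF sigma_finite_Gam fin(1,3) inj' disj(1), of \<delta>]
  note L = distr_splice_family[OF sigma_finite_lat fin(2,4) inj' disj(2), of \<delta>]
  have "distr (?G A \<Otimes>\<^sub>M ?G B) (?G (A \<union> h ` B)) (splice_family A B h) \<Otimes>\<^sub>M
      distr (?L A' \<Otimes>\<^sub>M ?L B') (?L (A' \<union> h ` B')) (splice_family A' B' h) =
    distr ((?G A \<Otimes>\<^sub>M ?G B) \<Otimes>\<^sub>M (?L A' \<Otimes>\<^sub>M ?L B')) (?G (A \<union> h ` B) \<Otimes>\<^sub>M ?L (A' \<union> h ` B')) ?sp"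
    using fin by (intro pair_measure_distr measurable_splice_family inj') (simp add: L sf)
  then have "?G (A \<union> h ` B) \<Otimes>\<^sub>M ?L (A' \<union> h ` B') =
    distr ((?G A \<Otimes>\<^sub>M ?G B) \<Otimes>\<^sub>M (?L A' \<Otimes>\<^sub>M ?L B')) (?G (A \<union> h ` B) \<Otimes>\<^sub>M ?L (A' \<union> h ` B')) ?sp"
    by (simp only: G L)
  also have "(?G A \<Otimes>\<^sub>M ?G B) \<Otimes>\<^sub>M (?L A' \<Otimes>\<^sub>M ?L B') =
      distr ((?G A \<Otimes>\<^sub>M ?L A') \<Otimes>\<^sub>M (?G B \<Otimes>\<^sub>M ?L B')) ((?G A \<Otimes>\<^sub>M ?G B) \<Otimes>\<^sub>M (?L A' \<Otimes>\<^sub>M ?L B')) ?sw"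
    by (rule pair_measure_middle_swap[symmetric]) (intro sf fin)+
  finally show ?distr
    unfolding vertex_measure_def eq distr_distr[OF sp sw] by (rule sym)
qed

section \<open>Measurability of the coefficients\<close>

lemma measurable_lat_measure [measurable (raw)]:
  "f \<in> measurable (lat_measure \<delta>) borel"
  by (simp add: measurable_def)

lemma measurable_snd_Gam_measure: "snd \<in> measurable (Gam_measure \<delta>) (lat_measure \<delta>)"
  unfolding Gam_measure_def by measurable

text \<open>\<open>Gam_measure\<close> carries the product of the Borel sets with the discrete
  algebra on the lattice, not the Borel algebra of the ambient space. The inclusion between the two
  lets Borel functions such as the Green function be evaluated at its points.\<close>

lemma measurable_Gam_measure_borel:
  "(\<lambda>x. x) \<in> borel_measurable (Gam_measure \<delta> :: 'd::finite point measure)"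
proof -
  have "snd \<in> borel_measurable (Gam_measure \<delta> :: 'd point measure)"
    using measurable_compose[OF measurable_snd_Gam_measure[of \<delta>] measurable_lat_measure[of "\<lambda>v. v"]]
    by simp
  moreover have "fst \<in> borel_measurable (Gam_measure \<delta> :: 'd point measure)"
    unfolding Gam_measure_def by measurable
  ultimately show ?thesis
    using borel_measurable_Pair[of fst "Gam_measure \<delta> :: 'd point measure" snd] by simp
qed

lemma borel_measurable_fst_snd:
  assumes "a \<in> measurable N (borel :: 'd::finite point measure)"
  shows "(\<lambda>z. fst (a z)) \<in> borel_measurable N" "(\<lambda>z. snd (a z)) \<in> borel_measurable N"
  using measurable_compose[OF assms borel_measurable_continuous_onI[of fst]]
    measurable_compose[OF assms borel_measurable_continuous_onI[of snd]]
  by (simp_all add: continuous_on_fst continuous_on_snd)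

text \<open>An integral over the Brillouin zone \<open>cbox 0 (\<chi> i. 2 * pi / \<delta>)\<close>
  depends measurably on the parameters time and position when its integrand is jointly
  measurable.\<close>

lemma borel_measurable_G_tilde:
  assumes [measurable]: "a \<in> borel_measurable N" "b \<in> borel_measurable N"
  shows "(\<lambda>z. G_tilde \<delta> m0 (a z) (b z :: real ^ 'd::finite)) \<in> borel_measurable N"
proof -
  have [measurable]: "(\<lambda>q :: real ^ 'd. q $ j) \<in> borel_measurable borel" for j
    by (intro borel_measurable_continuous_onI continuous_intros)
  have [measurable]: "(\<lambda>q :: real ^ 'd. mu_sq \<delta> m0 q) \<in> borel_measurable borel"
    unfolding mu_sq_def by measurable
  show ?thesis
    unfolding G_tilde_def G_tilde_complex_def set_lebesgue_integral_def by measurable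
qed

lemma borel_measurable_green:
  assumes "a \<in> measurable N (borel :: 'd::finite point measure)"
  shows "(\<lambda>z. green \<delta> m0 (a z)) \<in> borel_measurable N"
proof -
  note [measurable] = borel_measurable_fst_snd[OF assms]
    borel_measurable_G_tilde[OF borel_measurable_fst_snd[OF assms]]
  show ?thesis unfolding green_def by measurable
qed

text \<open>Joint measurability is needed because the integral of a non-measurable function is \<open>0\<close> by
  convention, so that almost everywhere equality alone does not determine an expectation.\<close>

lemma borel_measurable_X_coeff:
  fixes Y :: "'w \<Rightarrow> 'd::finite point \<Rightarrow> real"
  assumes Y: "case_prod Y \<in> borel_measurable (M \<Otimes>\<^sub>M Gam_measure \<delta>)"
  shows "(\<lambda>(\<omega>, x). X_coeff \<delta> m0 p f (Y \<omega>) j x) \<in> borel_measurable (M \<Otimes>\<^sub>M Gam_measure \<delta>)"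
proof (induction j rule: less_induct)
  case (less j)
  interpret L: sigma_finite_measure "lat_measure \<delta> :: (real ^ 'd) measure"
    by (rule sigma_finite_lat)
  interpret G: sigma_finite_measure "Gam_measure \<delta> :: 'd point measure"
    by (rule sigma_finite_Gam)
  have x: "(\<lambda>z. snd z) \<in> borel_measurable (M \<Otimes>\<^sub>M (Gam_measure \<delta> :: 'd point measure))"
    by (rule measurable_compose[OF measurable_snd measurable_Gam_measure_borel])
  note fx = borel_measurable_fst_snd[OF x]
  show ?case
  proof (cases j)
    case 0
    let ?N = "(M \<Otimes>\<^sub>M (Gam_measure \<delta> :: 'd point measure)) \<Otimes>\<^sub>M (lat_measure \<delta> :: (real ^ 'd) measure)"
    have v: "(\<lambda>z. h (snd z)) \<in> borel_measurable ?N" for h :: "real ^ 'd \<Rightarrow> 'b::topological_space"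
      by (rule measurable_compose[OF measurable_snd measurable_lat_measure])
    have "(\<lambda>z. G_tilde \<delta> m0 (fst (snd (fst z))) (snd (snd (fst z)) - snd z) * f (snd z)) \<in> borel_measurable ?N"
      by (intro borel_measurable_times borel_measurable_G_tilde borel_measurable_diff v
          measurable_compose[OF measurable_fst fx(1)] measurable_compose[OF measurable_fst fx(2)])
    then have [measurable]: "(\<lambda>z. LINT v|lat_measure \<delta>. G_tilde \<delta> m0 (fst (snd z)) (snd (snd z) - v) * f v)
        \<in> borel_measurable (M \<Otimes>\<^sub>M Gam_measure \<delta>)"
      by (intro L.borel_measurable_lebesgue_integral) (simp add: split_beta)
    note [measurable] = fx Y
    show ?thesis
      unfolding 0 split_beta X_coeff.simps using Y by (intro borel_measurable_add) (simp_all add: split_beta)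
  next
    case (Suc i)
    let ?N = "(M \<Otimes>\<^sub>M (Gam_measure \<delta> :: 'd point measure)) \<Otimes>\<^sub>M (Gam_measure \<delta> :: 'd point measure)"
    have y: "(\<lambda>z. snd z) \<in> borel_measurable ?N"
      by (rule measurable_compose[OF measurable_snd measurable_Gam_measure_borel])
    have X: "(\<lambda>z. X_coeff \<delta> m0 p f (Y (fst (fst z))) k (snd z)) \<in> borel_measurable ?N" if "k \<le> i" for k
    proof -
      have "(\<lambda>z. (fst (fst z), snd z)) \<in> measurable ?N (M \<Otimes>\<^sub>M Gam_measure \<delta>)" by measurable
      from measurable_compose[OF this less[of k]] show ?thesis
        using that Suc by simp
    qed
    have "(\<lambda>z. green \<delta> m0 (snd (fst z) - snd z) * (\<Sum>n\<in>exponents p i. fact p / (\<Prod>k\<le>i. fact (n k)) *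
           (\<Prod>k\<le>i. X_coeff \<delta> m0 p f (Y (fst (fst z))) k (snd z) ^ n k))) \<in> borel_measurable ?N"
      by (intro borel_measurable_times borel_measurable_green borel_measurable_diff y
          measurable_compose[OF measurable_fst x] borel_measurable_sum borel_measurable_const
          borel_measurable_prod borel_measurable_power X) simp
    then show ?thesis
      unfolding Suc split_beta X_coeff.simps
      by (intro G.borel_measurable_lebesgue_integral) (simp add: split_beta)
  qed
qed

lemma borel_measurable_X_coeff_at:
  fixes Y :: "'w \<Rightarrow> 'd::finite point \<Rightarrow> real"
  assumes "case_prod Y \<in> borel_measurable (M \<Otimes>\<^sub>M Gam_measure \<delta>)" and "x \<in> Gam \<delta>"
  shows "(\<lambda>\<omega>. X_coeff \<delta> m0 p f (Y \<omega>) j x) \<in> borel_measurable M"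
proof -
  have "(\<lambda>\<omega>. (\<omega>, x)) \<in> measurable M (M \<Otimes>\<^sub>M Gam_measure \<delta>)"
    using assms(2) by (intro measurable_Pair2') simp
  from measurable_compose[OF this borel_measurable_X_coeff[OF assms(1)]] show ?thesis by simp
qed

lemma borel_measurable_fps_nth_prod:
  fixes F :: "nat \<Rightarrow> 'w \<Rightarrow> real fps"
  assumes "\<And>i k. i < n \<Longrightarrow> (\<lambda>\<omega>. fps_nth (F i \<omega>) k) \<in> borel_measurable M"
  shows "(\<lambda>\<omega>. fps_nth (\<Prod>i<n. F i \<omega>) m) \<in> borel_measurable M"
  using assms
proof (induction n arbitrary: m)
  case (Suc n)
  show ?case
    unfolding prod.lessThan_Suc fps_mult_nth
    by (intro borel_measurable_sum borel_measurable_times Suc.IH Suc.prems) simp_all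
qed simp

section \<open>Integrals over forests\<close>

lemma forest_vertices_snoc:
  "forest_vertices (Ts @ [T]) =
    forest_vertices Ts @ map (apfst (\<lambda>(i, q). (length Ts + i, q))) (forest_vertices [T])"
  by (simp add: forest_vertices_def enumerate_append_eq comp_def split_beta)

text \<open>The children of a vertex are themselves a forest: the child index k, a tree index there,
  becomes the first entry of the address here.\<close>

lemma vertices_Inner:
  "vertices (Inner ts) = ([], Inner ts) # map (apfst (\<lambda>(k, q). k # q)) (forest_vertices ts)"
  by (simp add: forest_vertices_def map_concat comp_def case_prod_unfold)

declare vertices.simps(3) [simp del]

lemma forest_vertices_Inner:
  "forest_vertices [Inner ts] =
    ((0, []), Inner ts) # map (apfst (\<lambda>(k, q). (0, k # q))) (forest_vertices ts)"
proof -
  have "forest_vertices [T] = map (apfst (Pair 0)) (vertices T)" for T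
    by (simp add: forest_vertices_def split_beta apfst_def map_prod_def)
  then show ?thesis
    by (simp add: vertices_Inner comp_def case_prod_unfold apfst_def map_prod_def)
qed

text \<open>One statement for two relabellings: appending a tree shifts tree indices, and putting a
  forest below a new vertex lengthens addresses. \<open>L\<close> contains the vertices that do not
  come from \<open>Vs\<close>.\<close>

lemma vertices_shift:
  assumes "forest_vertices Ws = L @ map (apfst h) (forest_vertices Vs)"
  shows "inner_vertices Ws = {v. \<exists>ts. (v, Inner ts) \<in> set L} \<union> h ` inner_vertices Vs"
    and "leaves2 Ws = {v. (v, Leaf2) \<in> set L} \<union> h ` leaves2 Vs"
    and "leaves1 Ws = map fst (filter (\<lambda>(v, S). S = Leaf1) L) @ map h (leaves1 Vs)"
proof -
  have "(w, S) \<in> set (forest_vertices Ws) \<longleftrightarrow>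
      (w, S) \<in> set L \<or> (\<exists>v. w = h v \<and> (v, S) \<in> set (forest_vertices Vs))" for w S
    unfolding assms by (fastforce simp: image_iff)
  then show "inner_vertices Ws = {v. \<exists>ts. (v, Inner ts) \<in> set L} \<union> h ` inner_vertices Vs"
    "leaves2 Ws = {v. (v, Leaf2) \<in> set L} \<union> h ` leaves2 Vs"
    unfolding inner_vertices_def leaves2_def by blast+
  show "leaves1 Ws = map fst (filter (\<lambda>(v, S). S = Leaf1) L) @ map h (leaves1 Vs)"
    unfolding leaves1_def assms by (simp add: filter_map comp_def case_prod_unfold)
qed

lemma in_forest_vertices:
  "((i, q), S) \<in> set (forest_vertices Ts) \<longleftrightarrow> i < length Ts \<and> (q, S) \<in> set (vertices (Ts ! i))"
  by (force simp: forest_vertices_def in_set_enumerate_eq)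

lemma distinct_forest_vertices:
  assumes "\<And>T. T \<in> set Ts \<Longrightarrow> distinct (map fst (vertices T))"
  shows "distinct (map fst (forest_vertices Ts))"
  using assms
proof (induction Ts rule: rev_induct)
  case Nil
  then show ?case by (simp add: forest_vertices_def)
next
  case (snoc T Ts)
  let ?h = "\<lambda>(i, q). (length Ts + i, q :: nat list)"
  have "map fst (forest_vertices (Ts @ [T])) =
      map fst (forest_vertices Ts) @ map ?h (map fst (forest_vertices [T]))"
    unfolding forest_vertices_snoc by (simp add: comp_def split_beta)
  moreover have "distinct (map fst (forest_vertices Ts))"
    using snoc by simp
  moreover have "distinct (map ?h (map fst (forest_vertices [T])))"
    using snoc.prems[of T]
    by (auto simp: forest_vertices_def case_prod_unfold comp_def distinct_map inj_on_def)
  moreover have "fst v < length Ts" if "v \<in> set (map fst (forest_vertices Ts))" for v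
    using that by (auto simp: in_forest_vertices)
  moreover have "fst v \<ge> length Ts" if "v \<in> set (map ?h L)" for v L
    using that by auto
  ultimately show ?case
    by (simp only: distinct_append) (meson disjoint_iff leD)
qed

lemma distinct_vertices: "distinct (map fst (vertices T))"
proof (induction T)
  case (Inner ts)
  then have "distinct (map fst (forest_vertices ts))"
    by (intro distinct_forest_vertices)
  moreover have "map fst (vertices (Inner ts)) =
      [] # map (\<lambda>(k, q). k # q) (map fst (forest_vertices ts))"
    by (simp add: vertices_Inner comp_def split_beta)
  moreover have inj: "inj (\<lambda>(k :: nat, q). k # q)" by (auto simp: inj_def)
  have "distinct (map (\<lambda>(k, q). k # q) vs)" if "distinct vs" for vs :: "vertex list"
    using that inj_on_subset[OF inj subset_UNIV] by (simp add: distinct_map)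
  ultimately show ?case by (auto simp del: map_map)
qed simp_all

text \<open>Moments are indexed by positions in this list, graphs by sets of leaves. Distinctness
  makes positions and leaves correspond one to one.\<close>

lemma distinct_leaves1: "distinct (leaves1 Ts)"
proof -
  have "distinct (map fst (forest_vertices Ts))"
    by (intro distinct_forest_vertices distinct_vertices)
  then show ?thesis
    unfolding leaves1_def by (rule distinct_map_filter)
qed

lemma parent_in_vertices:
  "(q, S) \<in> set (vertices T) \<Longrightarrow> q \<noteq> [] \<Longrightarrow> \<exists>ts. (butlast q, Inner ts) \<in> set (vertices T)"
proof (induction T arbitrary: q)
  case (Inner ts)
  obtain k r where q: "q = k # r" and k: "k < length ts" "(r, S) \<in> set (vertices (ts ! k))"
    using Inner.prems unfolding vertices_Inner by (auto simp: in_forest_vertices)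
  show ?case
  proof (cases "r = []")
    case True
    then show ?thesis using q by (auto simp: vertices_Inner)
  next
    case False
    then obtain us where "(butlast r, Inner us) \<in> set (vertices (ts ! k))"
      using Inner.IH[OF nth_mem] k by blast
    then have "((k, butlast r), Inner us) \<in> set (forest_vertices ts)"
      using k by (simp add: in_forest_vertices)
    then have "(k # butlast r, Inner us) \<in> set (vertices (Inner ts))"
      unfolding vertices_Inner by force
    then show ?thesis using q False by auto
  qed
qed simp_all

text \<open>Ensures that \<open>parent_pos\<close> reads only coordinates that are integrated over;
  outside its index set a point of a product space has the value \<open>undefined\<close>.\<close>

lemma parent_in_inner_vertices:
  assumes "v \<in> inner_vertices Ts \<union> leaves2 Ts \<union> set (leaves1 Ts)" "snd v \<noteq> []"
  shows "(fst v, butlast (snd v)) \<in> inner_vertices Ts"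
proof -
  obtain S where "(v, S) \<in> set (forest_vertices Ts)"
    using assms(1) by (auto simp: inner_vertices_def leaves1_def leaves2_def)
  then show ?thesis
    using assms(2) parent_in_vertices[of "snd v" S "Ts ! fst v"]
    by (cases v) (auto simp: inner_vertices_def in_forest_vertices)
qed

lemma root_index_less:
  assumes "v \<in> inner_vertices Ts \<union> leaves2 Ts \<union> set (leaves1 Ts)"
  shows "fst v < length Ts"
  using assms by (cases v) (auto simp: inner_vertices_def leaves1_def leaves2_def in_forest_vertices)

lemma finite_inner_vertices: "finite (inner_vertices Ts)"
  by (rule finite_subset[of _ "fst ` set (forest_vertices Ts)"]) (force simp: inner_vertices_def)+

lemma finite_leaves2: "finite (leaves2 Ts)"
  by (rule finite_subset[of _ "fst ` set (forest_vertices Ts)"]) (force simp: leaves2_def)+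

section \<open>Factorisation of multiplicities, integrands and integrals\<close>

lemma forest_mult_append: "forest_mult (Ts @ [T]) = forest_mult Ts * forest_mult [T]"
  unfolding forest_mult_def forest_vertices_snoc
  by (simp add: comp_def case_prod_unfold)

lemma forest_mult_eq: "forest_mult Ts = (\<Prod>T\<leftarrow>Ts. forest_mult [T])"
proof (induction Ts rule: rev_induct)
  case Nil
  then show ?case by (simp add: forest_mult_def forest_vertices_def)
next
  case (snoc T Ts)
  then show ?case by (subst forest_mult_append) simp
qed

lemma forest_mult_Inner: "forest_mult [Inner ts] = vertex_mult (Inner ts) * forest_mult ts"
  unfolding forest_mult_def forest_vertices_Inner
  by (simp add: comp_def case_prod_unfold)

text \<open>Separating the vertex sets from the forest lets the root vertex of a tree, whose label changes when
  its subtrees are cut off, be treated as a vertex set of its own.\<close>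

definition position_integrand :: "real \<Rightarrow> real \<Rightarrow> (real ^ 'd::finite \<Rightarrow> real) \<Rightarrow> ('d point \<Rightarrow> real) \<Rightarrow>
    (nat \<Rightarrow> 'd point) \<Rightarrow> vertex set \<Rightarrow> vertex set \<Rightarrow> vertex list \<Rightarrow>
    (vertex \<Rightarrow> 'd point) \<times> (vertex \<Rightarrow> real ^ 'd) \<Rightarrow> real" where
  "position_integrand \<delta> m0 f g x A A' L u =
     (\<Prod>v\<in>A. green \<delta> m0 (parent_pos x (fst u) v - fst u v)) *
     (\<Prod>v\<in>A'. green \<delta> m0 (parent_pos x (fst u) v - (0, snd u v)) * f (snd u v)) *
     (\<Prod>v\<leftarrow>L. g (parent_pos x (fst u) v))"

definition forest_integrand :: "real \<Rightarrow> real \<Rightarrow> (real ^ 'd::finite \<Rightarrow> real) \<Rightarrow> ('d point \<Rightarrow> real) \<Rightarrow>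
    pw_tree list \<Rightarrow> (nat \<Rightarrow> 'd point) \<Rightarrow> (vertex \<Rightarrow> 'd point) \<times> (vertex \<Rightarrow> real ^ 'd) \<Rightarrow> real" where
  "forest_integrand \<delta> m0 f g Ts x =
     position_integrand \<delta> m0 f g x (inner_vertices Ts) (leaves2 Ts) (leaves1 Ts)"

lemma tree_integrand_eq: "tree_integrand \<delta> m0 f g T x = forest_integrand \<delta> m0 f g [T] (\<lambda>_. x)"
  by (rule ext) (simp add: tree_integrand_def forest_integrand_def position_integrand_def
      forest_kernel_def split_beta)

lemma forest_measure_eq: "forest_measure \<delta> Ts = vertex_measure \<delta> (inner_vertices Ts) (leaves2 Ts)"
  by (simp add: forest_measure_def vertex_measure_def)

text \<open>By \<open>par\<close> the first part is closed under parents, hence unaffected by the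
  second. By \<open>par'\<close> the second part sees \<open>x'\<close> as its roots. The choice of
  \<open>x'\<close> may depend on \<open>u\<close>, so that the second part can hang from a vertex
  of the first.\<close>

lemma position_integrand_splice:
  fixes h :: "vertex \<Rightarrow> vertex"
  assumes fin: "finite A" "finite A'" "finite B" "finite B'"
    and inj: "inj h" and disj: "A \<inter> h ` B = {}" "A' \<inter> h ` B' = {}"
    and par: "\<And>v. v \<in> A \<union> A' \<union> set L \<Longrightarrow> snd v \<noteq> [] \<Longrightarrow> (fst v, butlast (snd v)) \<in> A"
    and par': "\<And>v. v \<in> B \<union> B' \<union> set L' \<Longrightarrow>
      parent_pos x (splice_family A B h (fst u, fst u')) (h v) = parent_pos x' (fst u') v"
  shows "position_integrand \<delta> m0 f g x (A \<union> h ` B) (A' \<union> h ` B') (L @ map h L')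
      (splice_positions A A' B B' h (u, u')) =
    position_integrand \<delta> m0 f g x A A' L u * position_integrand \<delta> m0 f g x' B B' L' u'"
proof -
  let ?y = "splice_family A B h (fst u, fst u')" and ?z = "splice_family A' B' h (snd u, snd u')"
  have inj': "inj_on h C" for C using inj by (rule inj_on_subset) simp
  have sp: "splice_positions A A' B B' h (u, u') = (?y, ?z)"
    by (simp add: splice_positions_def split_beta)
  have par_A: "parent_pos x ?y v = parent_pos x (fst u) v" if "v \<in> A \<union> A' \<union> set L" for v
    using par[OF that] by (simp add: parent_pos_def splice_family_left)
  have "(\<Prod>v\<in>A \<union> h ` B. green \<delta> m0 (parent_pos x ?y v - ?y v)) =
      (\<Prod>v\<in>A. green \<delta> m0 (parent_pos x (fst u) v - fst u v)) *
      (\<Prod>v\<in>B. green \<delta> m0 (parent_pos x' (fst u') v - fst u' v))"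
    using fin disj by (simp add: prod.union_disjoint prod.reindex inj' par_A par'
        splice_family_left splice_family_right)
  moreover have "(\<Prod>v\<in>A' \<union> h ` B'. green \<delta> m0 (parent_pos x ?y v - (0, ?z v)) * f (?z v)) =
      (\<Prod>v\<in>A'. green \<delta> m0 (parent_pos x (fst u) v - (0, snd u v)) * f (snd u v)) *
      (\<Prod>v\<in>B'. green \<delta> m0 (parent_pos x' (fst u') v - (0, snd u' v)) * f (snd u' v))"
    using fin disj by (simp add: prod.union_disjoint prod.reindex inj' par_A par'
        splice_family_left splice_family_right)
  moreover have "(\<Prod>v\<leftarrow>L @ map h L'. g (parent_pos x ?y v)) =
      (\<Prod>v\<leftarrow>L. g (parent_pos x (fst u) v)) * (\<Prod>v\<leftarrow>L'. g (parent_pos x' (fst u') v))"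
    by (simp add: par_A par' comp_def cong: map_cong)
  ultimately show ?thesis
    by (simp add: position_integrand_def sp)
qed

lemma measurable_parent_pos:
  fixes x :: "nat \<Rightarrow> 'd::finite point"
  assumes "snd v = [] \<Longrightarrow> x (fst v) \<in> Gam \<delta>" "snd v \<noteq> [] \<Longrightarrow> (fst v, butlast (snd v)) \<in> A"
  shows "(\<lambda>u. parent_pos x (fst u) v) \<in> measurable (vertex_measure \<delta> A A') (Gam_measure \<delta>)"
proof (cases "snd v = []")
  case False
  then have "(\<lambda>u. fst u (fst v, butlast (snd v))) \<in> measurable (vertex_measure \<delta> A A') (Gam_measure \<delta>)"
    unfolding vertex_measure_def
    by (intro measurable_compose[OF measurable_fst measurable_component_singleton] assms(2))
  then show ?thesis using False by (simp add: parent_pos_def)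
qed (use assms(1) in \<open>simp add: parent_pos_def\<close>)

lemma borel_measurable_prod_list:
  fixes F :: "'i \<Rightarrow> 'a \<Rightarrow> real"
  assumes "\<And>i. i \<in> set L \<Longrightarrow> F i \<in> borel_measurable M"
  shows "(\<lambda>u. \<Prod>i\<leftarrow>L. F i u) \<in> borel_measurable M"
  using assms by (induction L) (simp_all add: borel_measurable_times)

lemma borel_measurable_position_integrand:
  fixes x :: "nat \<Rightarrow> 'd::finite point"
  assumes g: "g \<in> borel_measurable (Gam_measure \<delta>)"
    and par: "\<And>v. v \<in> A \<union> A' \<union> set L \<Longrightarrow> snd v \<noteq> [] \<Longrightarrow> (fst v, butlast (snd v)) \<in> A"
    and x: "\<And>v. v \<in> A \<union> A' \<union> set L \<Longrightarrow> x (fst v) \<in> Gam \<delta>"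
  shows "position_integrand \<delta> m0 f g x A A' L \<in> borel_measurable (vertex_measure \<delta> A A')"
proof -
  let ?M = "vertex_measure \<delta> A A' :: ((vertex \<Rightarrow> 'd point) \<times> (vertex \<Rightarrow> real ^ 'd)) measure"
  have P: "(\<lambda>u. parent_pos x (fst u) v) \<in> measurable ?M (Gam_measure \<delta>)"
    if "v \<in> A \<union> A' \<union> set L" for v
    using par[OF that] x[OF that] by (intro measurable_parent_pos)
  note P' = measurable_compose[OF P measurable_Gam_measure_borel]
  have y: "(\<lambda>u. fst u v) \<in> borel_measurable ?M" if "v \<in> A" for v
    unfolding vertex_measure_def
    by (rule measurable_compose[OF measurable_compose[OF measurable_fst
          measurable_component_singleton[OF that]] measurable_Gam_measure_borel])
  have z: "(\<lambda>u. k (snd u v)) \<in> borel_measurable ?M" if "v \<in> A'" for v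
    and k :: "real ^ 'd \<Rightarrow> 'b::topological_space"
    unfolding vertex_measure_def
    by (rule measurable_compose[OF measurable_compose[OF measurable_snd
          measurable_component_singleton[OF that]] measurable_lat_measure])
  show ?thesis
    unfolding position_integrand_def
    by (intro borel_measurable_times borel_measurable_prod borel_measurable_green
        borel_measurable_diff borel_measurable_prod_list y z P' measurable_compose[OF P g]
        borel_measurable_Pair) auto
qed

lemma integrable_pair_times:
  fixes f :: "'a \<Rightarrow> real" and g :: "'b \<Rightarrow> real"
  assumes "sigma_finite_measure M" "sigma_finite_measure N"
    and f: "integrable M f" and g: "integrable N g"
  shows "integrable (M \<Otimes>\<^sub>M N) (\<lambda>z. f (fst z) * g (snd z))" (is ?int)
    and "(LINT z|(M \<Otimes>\<^sub>M N). f (fst z) * g (snd z)) = integral\<^sup>L M f * integral\<^sup>L N g" (is ?eq)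
proof -
  interpret M: sigma_finite_measure M by fact
  interpret N: sigma_finite_measure N by fact
  interpret pair_sigma_finite M N ..
  note [measurable] = borel_measurable_integrable[OF f] borel_measurable_integrable[OF g]
  show int: ?int
  proof (rule Fubini_integrable)
    show "(\<lambda>z. f (fst z) * g (snd z)) \<in> borel_measurable (M \<Otimes>\<^sub>M N)" by measurable
    show "integrable M (\<lambda>x. LINT y|N. norm (f (fst (x, y)) * g (snd (x, y))))"
      using f by (simp add: abs_mult)
    show "AE x in M. integrable N (\<lambda>y. f (fst (x, y)) * g (snd (x, y)))"
      using g by simp
  qed
  show ?eq
    using integral_fst'[OF int] by simp
qed

text \<open>Integrability is an equivalence because it is used in both directions: forests are
  assembled from trees with known integrals, and a convergent tree integral is split at its top
  vertex.\<close>

lemma integrable_vertex_measure_splice: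
  fixes F :: "(vertex \<Rightarrow> 'd::finite point) \<times> (vertex \<Rightarrow> real ^ 'd) \<Rightarrow> real" and h :: "vertex \<Rightarrow> vertex"
  assumes "finite A" "finite A'" "finite B" "finite B'"
    and "inj h" and "A \<inter> h ` B = {}" "A' \<inter> h ` B' = {}"
    and F: "F \<in> borel_measurable (vertex_measure \<delta> (A \<union> h ` B) (A' \<union> h ` B'))"
  shows "integrable (vertex_measure \<delta> (A \<union> h ` B) (A' \<union> h ` B')) F \<longleftrightarrow>
      integrable (vertex_measure \<delta> A A' \<Otimes>\<^sub>M vertex_measure \<delta> B B')
        (\<lambda>z. F (splice_positions A A' B B' h z))"
    and "integral\<^sup>L (vertex_measure \<delta> (A \<union> h ` B) (A' \<union> h ` B')) F =
      (LINT z|(vertex_measure \<delta> A A' \<Otimes>\<^sub>M vertex_measure \<delta> B B'). F (splice_positions A A' B B' h z))"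
proof -
  note D = distr_splice_positions[OF assms(1-7), where \<delta> = \<delta>]
  show "integrable (vertex_measure \<delta> (A \<union> h ` B) (A' \<union> h ` B')) F \<longleftrightarrow>
      integrable (vertex_measure \<delta> A A' \<Otimes>\<^sub>M vertex_measure \<delta> B B')
        (\<lambda>z. F (splice_positions A A' B B' h z))"
    using integrable_distr_eq[OF D(1) F] unfolding D(2) .
  show "integral\<^sup>L (vertex_measure \<delta> (A \<union> h ` B) (A' \<union> h ` B')) F =
      (LINT z|(vertex_measure \<delta> A A' \<Otimes>\<^sub>M vertex_measure \<delta> B B'). F (splice_positions A A' B B' h z))"
    using integral_distr[OF D(1) F] unfolding D(2) .
qed

lemma borel_measurable_forest_integrand:
  assumes "g \<in> borel_measurable (Gam_measure \<delta>)" "\<And>i. i < length Ts \<Longrightarrow> x i \<in> Gam \<delta>"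
  shows "forest_integrand \<delta> m0 f g Ts x \<in> borel_measurable (forest_measure \<delta> Ts)"
  unfolding forest_integrand_def forest_measure_eq
  using assms parent_in_inner_vertices[of _ Ts] root_index_less[of _ Ts]
  by (intro borel_measurable_position_integrand) auto

text \<open>Different trees share no integration variables, so the integrand is a product of
  functions of separate variables. Trees are appended one at a time, and Fubini's theorem is applied
  to the last factor.\<close>

lemma forest_integral_eq_prod:
  fixes x :: "nat \<Rightarrow> 'd::finite point"
  assumes g: "g \<in> borel_measurable (Gam_measure \<delta>)"
    and "\<And>i. i < length Ts \<Longrightarrow> x i \<in> Gam \<delta>"
    and "\<And>i. i < length Ts \<Longrightarrow> integrable (forest_measure \<delta> [Ts ! i]) (tree_integrand \<delta> m0 f g (Ts ! i) (x i))"
  shows "integrable (forest_measure \<delta> Ts) (forest_integrand \<delta> m0 f g Ts x) \<and>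
    integral\<^sup>L (forest_measure \<delta> Ts) (forest_integrand \<delta> m0 f g Ts x) =
      (\<Prod>i<length Ts. integral\<^sup>L (forest_measure \<delta> [Ts ! i]) (tree_integrand \<delta> m0 f g (Ts ! i) (x i)))"
  using assms(2,3)
proof (induction Ts rule: rev_induct)
  case Nil
  \<comment> \<open>The empty forest has no variables: its measure is the unit mass at the pair of
    undefined functions and its integrand is the empty product 1.\<close>
  have "forest_measure \<delta> [] = (count_space {(\<lambda>_. undefined, \<lambda>_. undefined)} ::
      ((vertex \<Rightarrow> 'd point) \<times> (vertex \<Rightarrow> real ^ 'd)) measure)"
    by (simp add: forest_measure_def inner_vertices_def leaves2_def forest_vertices_def
        PiM_empty pair_measure_countable)
  then show ?case
    by (simp add: forest_integrand_def position_integrand_def inner_vertices_def leaves1_def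
        leaves2_def forest_vertices_def integrable_count_space lebesgue_integral_count_space_finite)
next
  case (snoc T Ts)
  define n where "n = length Ts"
  define h :: "vertex \<Rightarrow> vertex" where "h = (\<lambda>(i, q). (n + i, q))"
  let ?A = "inner_vertices Ts" and ?A' = "leaves2 Ts" and ?L = "leaves1 Ts"
  let ?B = "inner_vertices [T]" and ?B' = "leaves2 [T]" and ?L' = "leaves1 [T]"
  have fv: "forest_vertices (Ts @ [T]) = forest_vertices Ts @ map (apfst h) (forest_vertices [T])"
    by (simp add: forest_vertices_snoc h_def n_def)
  have inj: "inj h" by (auto simp: h_def inj_def)
  have vert: "inner_vertices (Ts @ [T]) = ?A \<union> h ` ?B" "leaves2 (Ts @ [T]) = ?A' \<union> h ` ?B'"
    "leaves1 (Ts @ [T]) = ?L @ map h ?L'"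
    unfolding vertices_shift[OF fv] by (simp_all add: inner_vertices_def leaves2_def leaves1_def)
  have ge: "fst (h v) \<ge> n" for v by (simp add: h_def split_beta)
  have lt: "fst v < n" if "v \<in> ?A \<union> ?A' \<union> set ?L" for v
    using root_index_less[OF that] by (simp add: n_def)
  have "h v \<notin> ?A \<union> ?A'" for v
    using ge[of v] lt[of "h v"] by auto
  then have disj: "?A \<inter> h ` ?B = {}" "?A' \<inter> h ` ?B' = {}" by blast+
  \<comment> \<open>The appended tree has index n in the forest, so its top vertex hangs from
    \<open>x n\<close>; vertices further down have parents in the shifted copy.\<close>
  have par: "parent_pos x (splice_family ?A ?B h (y, y')) (h v) = parent_pos (\<lambda>_. x n) y' v"
    if "v \<in> ?B \<union> ?B' \<union> set ?L'" for v y y'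
  proof (cases "snd v = []")
    case True
    then show ?thesis
      using root_index_less[OF that] by (simp add: parent_pos_def h_def split_beta)
  next
    case False
    have "(fst (h v), butlast (snd (h v))) = h (fst v, butlast (snd v))"
      by (simp add: h_def split_beta)
    then show ?thesis
      using False parent_in_inner_vertices[OF that False]
      by (simp add: parent_pos_def splice_family_right[OF inj_on_subset[OF inj] disj(1)])
        (simp add: h_def split_beta)
  qed
  note fin = finite_inner_vertices[of Ts] finite_leaves2[of Ts]
    finite_inner_vertices[of "[T]"] finite_leaves2[of "[T]"]
  have factor: "forest_integrand \<delta> m0 f g (Ts @ [T]) x (splice_positions ?A ?A' ?B ?B' h z) =
      forest_integrand \<delta> m0 f g Ts x (fst z) * tree_integrand \<delta> m0 f g T (x n) (snd z)" for z
    unfolding forest_integrand_def tree_integrand_eq vert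
    using position_integrand_splice[OF fin inj disj, of ?L ?L' x "fst z" "snd z" "\<lambda>_. x n"]
      parent_in_inner_vertices par by simp
  have IH: "integrable (forest_measure \<delta> Ts) (forest_integrand \<delta> m0 f g Ts x)"
    "integral\<^sup>L (forest_measure \<delta> Ts) (forest_integrand \<delta> m0 f g Ts x) =
      (\<Prod>i<length Ts. integral\<^sup>L (forest_measure \<delta> [Ts ! i]) (tree_integrand \<delta> m0 f g (Ts ! i) (x i)))"
  proof -
    have "x i \<in> Gam \<delta>"
      "integrable (forest_measure \<delta> [Ts ! i]) (tree_integrand \<delta> m0 f g (Ts ! i) (x i))"
      if "i < length Ts" for i
      using snoc.prems(1)[of i] snoc.prems(2)[of i] that by (simp_all add: nth_append)
    then show "integrable (forest_measure \<delta> Ts) (forest_integrand \<delta> m0 f g Ts x)"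
      "integral\<^sup>L (forest_measure \<delta> Ts) (forest_integrand \<delta> m0 f g Ts x) =
      (\<Prod>i<length Ts. integral\<^sup>L (forest_measure \<delta> [Ts ! i]) (tree_integrand \<delta> m0 f g (Ts ! i) (x i)))"
      using snoc.IH by blast+
  qed
  have T: "integrable (forest_measure \<delta> [T]) (tree_integrand \<delta> m0 f g T (x n))"
    using snoc.prems(2)[of n] by (simp add: n_def)
  have sf: "sigma_finite_measure (forest_measure \<delta> Us :: ((vertex \<Rightarrow> 'd point) \<times> _) measure)" for Us
    unfolding forest_measure_eq
    by (intro sigma_finite_vertex_measure finite_inner_vertices finite_leaves2)
  have meas: "forest_integrand \<delta> m0 f g (Ts @ [T]) x \<in> borel_measurable (forest_measure \<delta> (Ts @ [T]))"
    using g snoc.prems(1) by (rule borel_measurable_forest_integrand)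
  note S = integrable_vertex_measure_splice[OF fin inj disj meas[unfolded forest_measure_eq vert],
      unfolded factor, folded forest_measure_eq vert]
  note P = integrable_pair_times[OF sf sf IH(1) T]
  have "integrable (forest_measure \<delta> (Ts @ [T])) (forest_integrand \<delta> m0 f g (Ts @ [T]) x)"
    using S(1) P(1) by simp
  moreover have "integral\<^sup>L (forest_measure \<delta> (Ts @ [T])) (forest_integrand \<delta> m0 f g (Ts @ [T]) x) =
      (\<Prod>i<length Ts. integral\<^sup>L (forest_measure \<delta> [Ts ! i]) (tree_integrand \<delta> m0 f g (Ts ! i) (x i))) *
      integral\<^sup>L (forest_measure \<delta> [T]) (tree_integrand \<delta> m0 f g T (x n))"
    using S(2) P(2) IH(2) by simp
  ultimately show ?case
    by (simp add: n_def nth_append)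
qed

text \<open>Turns the integral over the position of a single inner vertex into an integral over
  \<Gamma>. The factor for the empty set of leaves is a unit mass at one point.\<close>

lemma vertex_measure_singleton:
  shows "distr (Gam_measure \<delta> :: 'd::finite point measure)
    (vertex_measure \<delta> {r} {}) (\<lambda>y. (\<lambda>v\<in>{r}. y, \<lambda>_. undefined)) = vertex_measure \<delta> {r} {}"
    (is "distr ?G _ ?m = _")
    and "(\<lambda>y. (\<lambda>v\<in>{r}. y, \<lambda>_. undefined)) \<in> measurable (Gam_measure \<delta> :: 'd point measure) (vertex_measure \<delta> {r} {})"
proof -
  let ?P = "PiM {r} (\<lambda>_. ?G)" and ?Q = "PiM {} (\<lambda>_. lat_measure \<delta> :: (real ^ 'd) measure) :: (vertex \<Rightarrow> real ^ 'd) measure"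
  interpret G: sigma_finite_measure ?G by (rule sigma_finite_Gam)
  interpret product_sigma_finite "\<lambda>_ :: vertex. ?G" ..
  have m1: "(\<lambda>y. \<lambda>v\<in>{r}. y) \<in> measurable ?G ?P"
    by (rule measurable_restrict) simp
  have m2: "(\<lambda>_. \<lambda>_. undefined) \<in> measurable ?G ?Q"
    by (rule measurable_const) (simp add: space_PiM)
  show m: "?m \<in> measurable ?G (vertex_measure \<delta> {r} {})"
    unfolding vertex_measure_def by (rule measurable_Pair[OF m1 m2])
  have P: "distr ?G ?P (\<lambda>y. \<lambda>v\<in>{r}. y) = ?P"
  proof (rule PiM_eqI)
    fix E assume E: "\<And>i. i \<in> {r} \<Longrightarrow> E i \<in> sets ?G"
    have "(\<lambda>y. \<lambda>v\<in>{r}. y) -` Pi\<^sub>E {r} E \<inter> space ?G = E r"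
      using sets.sets_into_space[OF E[of r]] by (auto simp: PiE_iff)
    moreover have "Pi\<^sub>E {r} E \<in> sets ?P" using E by (intro sets_PiM_I_finite) auto
    ultimately show "emeasure (distr ?G ?P (\<lambda>y. \<lambda>v\<in>{r}. y)) (Pi\<^sub>E {r} E) = (\<Prod>i\<in>{r}. emeasure ?G (E i))"
      by (simp add: emeasure_distr[OF m1])
  qed simp_all
  show "distr ?G (vertex_measure \<delta> {r} {}) ?m = vertex_measure \<delta> {r} {}"
    unfolding vertex_measure_def
  proof (rule pair_measure_eqI[symmetric])
    show "sigma_finite_measure ?P" by (rule sigma_finite_PiM[OF sigma_finite_Gam]) simp
    show "sigma_finite_measure ?Q" by (rule sigma_finite_PiM[OF sigma_finite_lat]) simp
    show "sets (?P \<Otimes>\<^sub>M ?Q) = sets (distr ?G (?P \<Otimes>\<^sub>M ?Q) ?m)" by simp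
    fix C E assume C: "C \<in> sets ?P" and E: "E \<in> sets ?Q"
    have "emeasure (distr ?G (?P \<Otimes>\<^sub>M ?Q) ?m) (C \<times> E) = emeasure ?G (?m -` (C \<times> E) \<inter> space ?G)"
      using m C E unfolding vertex_measure_def by (intro emeasure_distr) auto
    also have "\<dots> = emeasure ?P C * emeasure ?Q E"
    \<comment> \<open>A measurable set for the empty product is either that one point or
      empty.\<close>
    proof (cases "(\<lambda>_. undefined) \<in> E")
      case True
      then have "E = {\<lambda>_. undefined}" using E by (auto simp: PiM_empty)
      then have "emeasure ?Q E = 1" by (simp add: PiM_empty)
      moreover have "emeasure ?P C = emeasure ?G ((\<lambda>y. \<lambda>v\<in>{r}. y) -` C \<inter> space ?G)"
        by (subst P[symmetric]) (rule emeasure_distr[OF m1 C])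
      ultimately show ?thesis using True by (simp add: vimage_def)
    next
      case False
      then have "E = {}" using E by (auto simp: PiM_empty)
      then show ?thesis by simp
    qed
    finally show "emeasure ?P C * emeasure ?Q E = emeasure (distr ?G (?P \<Otimes>\<^sub>M ?Q) ?m) (C \<times> E)" ..
  qed
qed

text \<open>Fubini's theorem in the position y of the top inner vertex: the attached trees become a
  forest all of whose roots lie at y. Measurability and integrability of the inner integral in y are
  inherited from the whole tree.\<close>

lemma tree_integral_Inner:
  fixes x :: "'d::finite point"
  assumes int: "integrable (forest_measure \<delta> [Inner ts]) (tree_integrand \<delta> m0 f g (Inner ts) x)"
  shows "integrable (Gam_measure \<delta>)
      (\<lambda>y. green \<delta> m0 (x - y) * integral\<^sup>L (forest_measure \<delta> ts) (forest_integrand \<delta> m0 f g ts (\<lambda>_. y)))"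
      (is "integrable _ ?H")
    and "integral\<^sup>L (forest_measure \<delta> [Inner ts]) (tree_integrand \<delta> m0 f g (Inner ts) x) =
      (LINT y|Gam_measure \<delta>. green \<delta> m0 (x - y) *
        integral\<^sup>L (forest_measure \<delta> ts) (forest_integrand \<delta> m0 f g ts (\<lambda>_. y)))"
proof -
  let ?r = "(0, []) :: vertex"
  define h :: "vertex \<Rightarrow> vertex" where "h = (\<lambda>(k, q). (0, k # q))"
  let ?B = "inner_vertices ts" and ?B' = "leaves2 ts" and ?L' = "leaves1 ts"
  have fv: "forest_vertices [Inner ts] = (?r, Inner ts) # map (apfst h) (forest_vertices ts)"
    by (simp add: forest_vertices_Inner h_def)
  have inj: "inj h" by (auto simp: h_def inj_def)
  have vert: "inner_vertices [Inner ts] = {?r} \<union> h ` ?B" "leaves2 [Inner ts] = {} \<union> h ` ?B'"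
    "leaves1 [Inner ts] = [] @ map h ?L'"
    using vertices_shift[of "[Inner ts]" "[(?r, Inner ts)]" h ts] fv by auto
  have disj: "{?r} \<inter> h ` ?B = {}" "{} \<inter> h ` ?B' = {}"
    by (auto simp: h_def split_beta)
  \<comment> \<open>A top vertex of an attached tree gets an address with one entry, so its parent
    is \<open>?r\<close>; in the forest \<open>ts\<close> its root therefore lies at
    \<open>y ?r\<close>.\<close>
  have par: "parent_pos (\<lambda>_. x) (splice_family {?r} ?B h (y, y')) (h v) = parent_pos (\<lambda>_. y ?r) y' v"
    if "v \<in> ?B \<union> ?B' \<union> set ?L'" for v y y'
  proof (cases "snd v = []")
    case True
    then show ?thesis
      by (simp add: parent_pos_def h_def split_beta splice_family_left)
  next
    case False
    have "(fst (h v), butlast (snd (h v))) = h (fst v, butlast (snd v))" "snd (h v) \<noteq> []"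
      using False by (simp_all add: h_def split_beta)
    then show ?thesis
      using False parent_in_inner_vertices[OF that False]
      by (simp add: parent_pos_def splice_family_right[OF inj_on_subset[OF inj] disj(1)])
  qed
  note fin = finite.insertI[OF finite.emptyI, of ?r] finite.emptyI[where 'a = vertex]
    finite_inner_vertices[of ts] finite_leaves2[of ts]
  have factor: "tree_integrand \<delta> m0 f g (Inner ts) x (splice_positions {?r} {} ?B ?B' h z) =
      green \<delta> m0 (x - fst (fst z) ?r) * forest_integrand \<delta> m0 f g ts (\<lambda>_. fst (fst z) ?r) (snd z)" for z
    unfolding forest_integrand_def tree_integrand_eq vert
    using position_integrand_splice[OF fin inj disj, of "[]" ?L' "\<lambda>_. x" "fst z" "snd z" "\<lambda>_. fst (fst z) ?r" \<delta> m0 f g] par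
    by (simp add: position_integrand_def parent_pos_def)
  let ?V = "vertex_measure \<delta> {?r} {} :: ((vertex \<Rightarrow> 'd point) \<times> (vertex \<Rightarrow> real ^ 'd)) measure"
  let ?F = "forest_measure \<delta> ts :: ((vertex \<Rightarrow> 'd point) \<times> (vertex \<Rightarrow> real ^ 'd)) measure"
  note S = integrable_vertex_measure_splice[OF fin inj disj
      borel_measurable_integrable[OF int, unfolded forest_measure_eq vert],
      unfolded factor, folded forest_measure_eq vert]
  interpret V: sigma_finite_measure ?V by (rule sigma_finite_vertex_measure) simp_all
  interpret F: sigma_finite_measure ?F
    unfolding forest_measure_eq by (intro sigma_finite_vertex_measure fin)
  interpret pair_sigma_finite ?V ?F ..
  have int': "integrable (?V \<Otimes>\<^sub>M ?F)
      (\<lambda>z. green \<delta> m0 (x - fst (fst z) ?r) * forest_integrand \<delta> m0 f g ts (\<lambda>_. fst (fst z) ?r) (snd z))"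
    using S(1) int by simp
  note D = vertex_measure_singleton[where \<delta> = \<delta> and r = ?r and ?'d = 'd]
  have intV: "integrable ?V (\<lambda>u. ?H (fst u ?r))"
    using integrable_fst'[OF int'] by simp
  note measV = borel_measurable_integrable[OF intV]
  show "integrable (Gam_measure \<delta>) ?H"
    using integrable_distr_eq[OF D(2) measV] intV unfolding D(1) by simp
  have "integral\<^sup>L (forest_measure \<delta> [Inner ts]) (tree_integrand \<delta> m0 f g (Inner ts) x) =
      (LINT u|?V. ?H (fst u ?r))"
    using S(2) integral_fst'[OF int'] by simp
  also have "\<dots> = (LINT y|Gam_measure \<delta>. ?H y)"
    using integral_distr[OF D(2) measV] unfolding D(1) by simp
  finally show "integral\<^sup>L (forest_measure \<delta> [Inner ts]) (tree_integrand \<delta> m0 f g (Inner ts) x) =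
      (LINT y|Gam_measure \<delta>. ?H y)" .
qed

section \<open>Moments and truncated moments\<close>

text \<open>The hypothesis is what the empty list requires: there the only partition is empty, and the
  recursion for \<open>truncated\<close> does not apply to it.\<close>

lemma moment_eq_sum_truncated:
  assumes "moment \<mu> [] = 1"
  shows "moment \<mu> gs = (\<Sum>I | partition_on {..<length gs} I. \<Prod>B\<in>I. truncated \<mu> (nths gs B))"
proof (cases "gs = []")
  case True
  have "{I :: nat set set. partition_on {} I} = {{}}" by (auto simp: partition_on_empty)
  then show ?thesis using True assms by simp
next
  case False
  let ?U = "{..<length gs}"
  have whole: "partition_on ?U {?U}"
    using False by (intro partition_on_space) (auto simp: lessThan_empty_iff)
  have "finite {I. partition_on ?U I}" by (rule finitely_many_partition_on) simp
  then have "(\<Sum>I | partition_on ?U I. \<Prod>B\<in>I. truncated \<mu> (nths gs B)) =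
      (\<Prod>B\<in>{?U}. truncated \<mu> (nths gs B)) +
      (\<Sum>I\<in>{I. partition_on ?U I} - {{?U}}. \<Prod>B\<in>I. truncated \<mu> (nths gs B))"
    using whole by (subst sum.remove[where x = "{?U}"]) auto
  also have "{I. partition_on ?U I} - {{?U}} = {I. partition_on ?U I \<and> I \<noteq> {?U}}" by auto
  also have "(\<Prod>B\<in>{?U}. truncated \<mu> (nths gs B)) = truncated \<mu> gs"
    by (simp add: nths_all)
  finally show ?thesis by (simp add: truncated.simps[of \<mu> gs])
qed

lemma bij_betw_partitions:
  assumes "bij_betw f A B"
  shows "bij_betw ((`) ((`) f)) {I. partition_on A I} {J. partition_on B J}"
proof (rule bij_betw_byWitness[where f' = "(`) ((`) (inv_into A f))"])
  have inj: "inj_on f A" and img: "f ` A = B" using assms by (auto simp: bij_betw_def)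
  have *: "partition_on (h ` C) ((`) ((`) h) I)" if "partition_on C I" "inj_on h C" for h :: "'c \<Rightarrow> 'd" and C I
    using partition_on_inj_image[OF that] partition_onD3[OF that(1)] by (simp add: image_iff)
  show "(`) ((`) f) ` {I. partition_on A I} \<subseteq> {J. partition_on B J}"
    using *[OF _ inj] img by auto
  have "inj_on (inv_into A f) B" "inv_into A f ` B = A"
    using bij_betw_inv_into[OF assms] by (auto simp: bij_betw_def)
  then show "(`) ((`) (inv_into A f)) ` {J. partition_on B J} \<subseteq> {I. partition_on A I}"
    using *[of B _ "inv_into A f"] by auto
  show "\<forall>I\<in>{I. partition_on A I}. (`) (inv_into A f) ` (`) f ` I = I"
  proof clarify
    fix I assume "partition_on A I"
    then have "inv_into A f ` f ` C = C" if "C \<in> I" for C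
      using that inj by (intro inv_into_image_cancel) (auto simp: partition_on_def)
    then show "(`) (inv_into A f) ` (`) f ` I = I" by (simp add: image_image)
  qed
  show "\<forall>J\<in>{J. partition_on B J}. (`) f ` (`) (inv_into A f) ` J = J"
  proof clarify
    fix J assume "partition_on B J"
    then have "f ` inv_into A f ` C = C" if "C \<in> J" for C
      using that img by (intro image_inv_into_cancel) (auto simp: partition_on_def)
    then show "(`) f ` (`) (inv_into A f) ` J = J" by (simp add: image_image)
  qed
qed

text \<open>The recursion for \<open>truncated\<close> partitions positions in a list, while graphs
  partition leaves. Both \<open>nths\<close> and \<open>filter\<close> keep the order of
  \<open>vs\<close>, so corresponding blocks give literally the same list of arguments.\<close>

lemma sum_partitions_nths:
  assumes "distinct vs"
  shows "(\<Sum>I | partition_on {..<length vs} I. \<Prod>B\<in>I. h (nths vs B)) =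
    (\<Sum>J | partition_on (set vs) J. \<Prod>B\<in>J. (h (filter (\<lambda>v. v \<in> B) vs) :: real))"
proof -
  let ?n = "(!) vs"
  have bij: "bij_betw ?n {..<length vs} (set vs)"
    by (rule bij_betw_nth[OF assms refl refl])
  have "(\<Sum>J | partition_on (set vs) J. \<Prod>B\<in>J. h (filter (\<lambda>v. v \<in> B) vs)) =
      (\<Sum>I | partition_on {..<length vs} I. \<Prod>B\<in>(`) ?n ` I. h (filter (\<lambda>v. v \<in> B) vs))"
    by (rule sum.reindex_bij_betw[OF bij_betw_partitions[OF bij], symmetric])
  also have "\<dots> = (\<Sum>I | partition_on {..<length vs} I. \<Prod>B\<in>I. h (nths vs B))"
  proof (rule sum.cong[OF refl], clarify)
    fix I assume I: "partition_on {..<length vs} I"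
    then have sub: "B \<subseteq> {..<length vs}" if "B \<in> I" for B
      using that by (auto simp: partition_on_def)
    \<comment> \<open>Distinct blocks must have distinct images, otherwise the product over the
      image partition would lose factors.\<close>
    have "inj_on ((`) ?n) I"
      using inj_on_image_Pow[of ?n "{..<length vs}"] bij sub
      by (auto simp: bij_betw_def intro: inj_on_subset)
    then have "(\<Prod>B\<in>(`) ?n ` I. h (filter (\<lambda>v. v \<in> B) vs)) =
        (\<Prod>B\<in>I. h (filter (\<lambda>v. v \<in> ?n ` B) vs))"
      by (simp add: prod.reindex)
    also have "\<dots> = (\<Prod>B\<in>I. h (nths vs B))"
    proof (rule prod.cong[OF refl])
      fix B assume "B \<in> I"
      then have "?n ` B = set (nths vs B)"
        using sub by (auto simp: set_nths)
      then show "h (filter (\<lambda>v. v \<in> ?n ` B) vs) = h (nths vs B)"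
        by (simp add: filter_in_nths[OF assms])
    qed
    finally show "(\<Prod>B\<in>(`) ?n ` I. h (filter (\<lambda>v. v \<in> B) vs)) = (\<Prod>B\<in>I. h (nths vs B))" .
  qed
  finally show ?thesis ..
qed

section \<open>The graph expansion\<close>

lemma prod_nth_eq_prod_list:
  fixes F :: "'a \<Rightarrow> 'b::comm_monoid_mult"
  shows "(\<Prod>i<length ts. F (ts ! i)) = (\<Prod>t\<leftarrow>ts. F t)"
  using prod.list_conv_set_nth[of "map F ts"] by (simp add: atLeast0LessThan)

section \<open>Recursion for tree values and identification with the coefficients\<close>

text \<open>The integral against the noise is already contained in \<open>g\<close>, so no
  integration variable remains and the measure is a unit point mass.\<close>

lemma tree_value_Leaf1: "tree_value \<delta> m0 f g Leaf1 x = g x"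
proof -
  have fv: "forest_vertices [Leaf1] = [((0, []), Leaf1)]"
    by (simp add: forest_vertices_def)
  have "forest_measure \<delta> [Leaf1] = (count_space {(\<lambda>_. undefined, \<lambda>_. undefined)} ::
      ((vertex \<Rightarrow> 'a point) \<times> (vertex \<Rightarrow> real ^ 'a)) measure)"
    by (simp add: forest_measure_def inner_vertices_def leaves2_def fv
        PiM_empty pair_measure_countable)
  then show ?thesis
    by (simp add: tree_value_def tree_integrand_eq forest_integrand_def position_integrand_def
        inner_vertices_def leaves1_def leaves2_def fv forest_mult_def parent_pos_def
        lebesgue_integral_count_space_finite)
qed

lemma tree_value_Leaf2:
  fixes x :: "'d::finite point"
  assumes "integrable (forest_measure \<delta> [Leaf2]) (tree_integrand \<delta> m0 f g Leaf2 x)"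
  shows "tree_value \<delta> m0 f g Leaf2 x = (LINT v|lat_measure \<delta>. green \<delta> m0 (x - (0, v)) * f v)"
proof -
  let ?r = "(0, []) :: vertex"
  let ?P = "PiM {} (\<lambda>_. Gam_measure \<delta>) :: (vertex \<Rightarrow> 'd point) measure"
  let ?Q = "PiM {?r} (\<lambda>_. lat_measure \<delta>) :: (vertex \<Rightarrow> real ^ 'd) measure"
  let ?F = "\<lambda>u. green \<delta> m0 (x - (0, snd u ?r)) * f (snd u ?r)"
  have fv: "forest_vertices [Leaf2] = [(?r, Leaf2)]"
    by (simp add: forest_vertices_def)
  have M: "forest_measure \<delta> [Leaf2] = ?P \<Otimes>\<^sub>M ?Q"
    by (simp add: forest_measure_def inner_vertices_def leaves2_def fv)
  have F: "tree_integrand \<delta> m0 f g Leaf2 x = ?F"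
    by (rule ext) (simp add: tree_integrand_eq forest_integrand_def position_integrand_def
        inner_vertices_def leaves1_def leaves2_def fv parent_pos_def)
  interpret L: sigma_finite_measure "lat_measure \<delta> :: (real ^ 'd) measure" by (rule sigma_finite_lat)
  interpret product_sigma_finite "\<lambda>_ :: vertex. lat_measure \<delta> :: (real ^ 'd) measure" ..
  interpret P: sigma_finite_measure ?P by (intro sigma_finite_PiM sigma_finite_Gam) simp
  interpret Q: sigma_finite_measure ?Q by (intro sigma_finite_PiM sigma_finite_lat) simp
  interpret pair_sigma_finite ?P ?Q ..
  have int: "integrable (?P \<Otimes>\<^sub>M ?Q) ?F" using assms unfolding M F .
  have "tree_value \<delta> m0 f g Leaf2 x = integral\<^sup>L (?P \<Otimes>\<^sub>M ?Q) ?F"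
    unfolding tree_value_def M F by (simp add: forest_mult_def fv)
  also have "\<dots> = (LINT u|?P. LINT v|?Q. ?F (u, v))"
    by (rule integral_fst'[OF int, symmetric])
  also have "\<dots> = (LINT v|?Q. green \<delta> m0 (x - (0, v ?r)) * f (v ?r))"
    by (simp add: PiM_empty lebesgue_integral_count_space_finite)
  also have "\<dots> = (LINT v|lat_measure \<delta>. green \<delta> m0 (x - (0, v)) * f v)"
    by (rule product_integral_singleton) (rule measurable_lat_measure)
  finally show ?thesis .
qed

text \<open>The tree is cut at its top vertex, the forest integral below it factors into tree
  integrals, and the multiplicity of the tree is that of the top vertex times those of the attached
  trees.\<close>

lemma tree_value_Inner:
  fixes x :: "'d::finite point"
  assumes g: "g \<in> borel_measurable (Gam_measure \<delta>)"
    and int: "integrable (forest_measure \<delta> [Inner ts]) (tree_integrand \<delta> m0 f g (Inner ts) x)"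
    and sub: "\<And>t y. t \<in> set ts \<Longrightarrow> y \<in> Gam \<delta> \<Longrightarrow>
      integrable (forest_measure \<delta> [t]) (tree_integrand \<delta> m0 f g t y)"
  shows "integrable (Gam_measure \<delta>)
      (\<lambda>y. green \<delta> m0 (x - y) * (vertex_mult (Inner ts) * (\<Prod>t\<leftarrow>ts. tree_value \<delta> m0 f g t y)))" (is ?int)
    and "tree_value \<delta> m0 f g (Inner ts) x = (LINT y|Gam_measure \<delta>. green \<delta> m0 (x - y) *
        (vertex_mult (Inner ts) * (\<Prod>t\<leftarrow>ts. tree_value \<delta> m0 f g t y)))" (is ?eq)
proof -
  let ?H = "\<lambda>y. green \<delta> m0 (x - y) * integral\<^sup>L (forest_measure \<delta> ts) (forest_integrand \<delta> m0 f g ts (\<lambda>_. y))"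
  have H: "green \<delta> m0 (x - y) * (vertex_mult (Inner ts) * (\<Prod>t\<leftarrow>ts. tree_value \<delta> m0 f g t y)) =
      forest_mult [Inner ts] * ?H y" if y: "y \<in> Gam \<delta>" for y
  proof -
    have "(\<Prod>t\<leftarrow>ts. tree_value \<delta> m0 f g t y) = forest_mult ts *
        (\<Prod>t\<leftarrow>ts. integral\<^sup>L (forest_measure \<delta> [t]) (tree_integrand \<delta> m0 f g t y))"
      by (simp add: tree_value_def forest_mult_eq[of ts] prod.distrib flip: prod_nth_eq_prod_list)
    also have "(\<Prod>t\<leftarrow>ts. integral\<^sup>L (forest_measure \<delta> [t]) (tree_integrand \<delta> m0 f g t y)) =
        integral\<^sup>L (forest_measure \<delta> ts) (forest_integrand \<delta> m0 f g ts (\<lambda>_. y))"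
      using forest_integral_eq_prod[OF g, of ts "\<lambda>_. y" m0 f] y sub by (simp flip: prod_nth_eq_prod_list)
    finally show ?thesis by (simp add: forest_mult_Inner)
  qed
  note I = tree_integral_Inner[OF int]
  show ?int
    using I(1) by (subst Bochner_Integration.integrable_cong[OF refl H]) auto
  have "tree_value \<delta> m0 f g (Inner ts) x = (LINT y|Gam_measure \<delta>. forest_mult [Inner ts] * ?H y)"
    by (simp add: tree_value_def I(2))
  also have "\<dots> = (LINT y|Gam_measure \<delta>. green \<delta> m0 (x - y) *
        (vertex_mult (Inner ts) * (\<Prod>t\<leftarrow>ts. tree_value \<delta> m0 f g t y)))"
    by (intro Bochner_Integration.integral_cong refl) (simp only: H space_Gam_measure)
  finally show ?eq .
qed

text \<open>A deterministic identity for one realisation \<open>g\<close>. With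
  \<open>multinomial_trees\<close> applied at each point y, the recursion for X has the same form as
  the recursion for tree values.\<close>

lemma X_coeff_eq_sum_trees:
  fixes x :: "'d::finite point"
  assumes g: "g \<in> borel_measurable (Gam_measure \<delta>)"
    and conv: "tree_integrals_converge \<delta> m0 p f g"
    and "x \<in> Gam \<delta>"
  shows "X_coeff \<delta> m0 p f g j x = (\<Sum>T\<in>trees p j. tree_value \<delta> m0 f g T x)"
  using assms(3)
proof (induction j arbitrary: x rule: less_induct)
  case (less j)
  have int: "integrable (forest_measure \<delta> [T]) (tree_integrand \<delta> m0 f g T y)"
    if "well_formed p T" "y \<in> Gam \<delta>" for T y
    using conv that by (auto simp: tree_integrals_converge_def trees_def)
  show ?case
  proof (cases j)
    case 0
    \<comment> \<open>The step function inside \<open>green\<close> reproduces the convention that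
      the contribution of the initial value is 0 for nonpositive times.\<close>
    have "(LINT v|lat_measure \<delta>. green \<delta> m0 (x - (0, v)) * f v) =
      (if fst x > 0 then LINT v|lat_measure \<delta>. G_tilde \<delta> m0 (fst x) (snd x - v) * f v else 0)"
      by (simp add: green_def)
    then show ?thesis
      by (simp add: 0 trees_0 tree_value_Leaf1 tree_value_Leaf2[OF int] less.prems)
  next
    case (Suc i)
    let ?S = "{ts. ts \<in> tree_lists p p i \<and> sorted (map tree_rank ts)}"
    let ?K = "\<lambda>ts y. green \<delta> m0 (x - y) * (vertex_mult (Inner ts) * (\<Prod>t\<leftarrow>ts. tree_value \<delta> m0 f g t y))"
    have wf: "well_formed p (Inner ts)" "\<And>t. t \<in> set ts \<Longrightarrow> well_formed p t" if "ts \<in> ?S" for ts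
      using that by (auto simp: tree_lists_def)
    have sub: "integrable (forest_measure \<delta> [t]) (tree_integrand \<delta> m0 f g t y)"
      if "ts \<in> ?S" "t \<in> set ts" "y \<in> Gam \<delta>" for ts t y
      using int[OF wf(2)[OF that(1,2)] that(3)] .
    have V: "integrable (Gam_measure \<delta>) (?K ts)"
        "tree_value \<delta> m0 f g (Inner ts) x = integral\<^sup>L (Gam_measure \<delta>) (?K ts)" if "ts \<in> ?S" for ts
      using tree_value_Inner[OF g int[OF wf(1)[OF that] less.prems] sub[OF that]] by simp_all
    have "(\<Sum>n\<in>exponents p i. fact p / (\<Prod>k\<le>i. fact (n k)) * (\<Prod>k\<le>i. X_coeff \<delta> m0 p f g k y ^ n k)) =
        (\<Sum>ts\<in>?S. vertex_mult (Inner ts) * (\<Prod>t\<leftarrow>ts. tree_value \<delta> m0 f g t y))"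
      if "y \<in> Gam \<delta>" for y
      unfolding multinomial_trees[symmetric] using less.IH that Suc
      by (intro sum.cong refl arg_cong2[where f = times] prod.cong) simp_all
    then have "X_coeff \<delta> m0 p f g j x = (LINT y|Gam_measure \<delta>. (\<Sum>ts\<in>?S. ?K ts y))"
      unfolding Suc X_coeff.simps
      by (intro Bochner_Integration.integral_cong refl) (simp only: sum_distrib_left space_Gam_measure)
    \<comment> \<open>The sum leaves the integral because \<open>V\<close> gives integrability for
      every single tree.\<close>
    also have "\<dots> = (\<Sum>ts\<in>?S. tree_value \<delta> m0 f g (Inner ts) x)"
      using V by (subst Bochner_Integration.integral_sum) simp_all
    also have "\<dots> = (\<Sum>T\<in>trees p j. tree_value \<delta> m0 f g T x)"
      unfolding Suc trees_Suc by (subst sum.reindex) (simp_all add: inj_on_def)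
    finally show ?thesis .
  qed
qed

section \<open>Products of the series and the sum over graphs\<close>

text \<open>Iterated Cauchy product: splitting off the last tree of a forest of weight m leaves one
  of weight k, and the signs for k and m - k combine to the sign for m.\<close>

lemma fps_nth_prod_trees:
  fixes V :: "nat \<Rightarrow> pw_tree \<Rightarrow> real"
  shows "fps_nth (\<Prod>i<n. Abs_fps (\<lambda>j. (-1) ^ j * (\<Sum>T\<in>trees p j. V i T))) m =
    (-1) ^ m * (\<Sum>Ts\<in>tree_lists p n m. \<Prod>i<n. V i (Ts ! i))"
proof (induction n arbitrary: m)
  case 0
  have "tree_lists p 0 m = (if m = 0 then {[]} else {})"
    by (auto simp: tree_lists_def)
  then show ?case by simp
next
  case (Suc n)
  let ?W = "\<lambda>Ts. \<Prod>i<n. V i (Ts ! i)"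
  let ?D = "SIGMA k:{0..m}. tree_lists p n k \<times> trees p (m - k)"
  have "fps_nth (\<Prod>i<Suc n. Abs_fps (\<lambda>j. (-1) ^ j * (\<Sum>T\<in>trees p j. V i T))) m =
      (\<Sum>k=0..m. (-1) ^ k * (\<Sum>Ts\<in>tree_lists p n k. ?W Ts) *
        ((-1) ^ (m - k) * (\<Sum>T\<in>trees p (m - k). V n T)))"
    by (simp add: fps_mult_nth Suc.IH)
  also have "\<dots> = (\<Sum>k=0..m. (-1) ^ m * (\<Sum>(Ts, T)\<in>tree_lists p n k \<times> trees p (m - k). ?W Ts * V n T))"
  proof (rule sum.cong[OF refl])
    fix k assume "k \<in> {0..m}"
    then have "(-1 :: real) ^ m = (-1) ^ k * (-1) ^ (m - k)" by (simp flip: power_add)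
    moreover have "(\<Sum>(Ts, T)\<in>tree_lists p n k \<times> trees p (m - k). ?W Ts * V n T) =
        (\<Sum>Ts\<in>tree_lists p n k. ?W Ts) * (\<Sum>T\<in>trees p (m - k). V n T)"
      by (simp only: sum_product sum.cartesian_product)
    ultimately show "(-1) ^ k * (\<Sum>Ts\<in>tree_lists p n k. ?W Ts) * ((-1) ^ (m - k) * (\<Sum>T\<in>trees p (m - k). V n T)) =
        (-1) ^ m * (\<Sum>(Ts, T)\<in>tree_lists p n k \<times> trees p (m - k). ?W Ts * V n T)"
      by simp
  qed
  also have "\<dots> = (-1) ^ m * (\<Sum>(k, Ts, T)\<in>?D. ?W Ts * V n T)"
    by (simp add: sum_distrib_left[symmetric] sum.Sigma finite_tree_lists finite_trees)
  also have "(\<Sum>(k, Ts, T)\<in>?D. ?W Ts * V n T) = (\<Sum>Us\<in>tree_lists p (Suc n) m. \<Prod>i<Suc n. V i (Us ! i))"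
  proof (rule sum.reindex_bij_witness[where
        i = "\<lambda>Us. (sum_list (map num_inner (butlast Us)), butlast Us, last Us)" and
        j = "\<lambda>(k, Ts, T). Ts @ [T]"])
    fix Us assume "Us \<in> tree_lists p (Suc n) m"
    then obtain Ts T where "Us = Ts @ [T]" "Ts @ [T] \<in> tree_lists p (Suc n) m"
      by (cases Us rule: rev_cases) (auto simp: tree_lists_def)
    then show "(case (sum_list (map num_inner (butlast Us)), butlast Us, last Us) of (k, Ts, T) \<Rightarrow> Ts @ [T]) = Us"
      "(sum_list (map num_inner (butlast Us)), butlast Us, last Us) \<in> ?D"
      by (auto simp: tree_lists_def trees_def)
  qed (auto simp: tree_lists_def trees_def nth_append)
  finally show ?case .
qed

text \<open>The function j in the definition is forced to be the number of inner vertices of each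
  tree. The sum over graphs thereby becomes a sum over forests followed by one over partitions of
  their leaves.\<close>

lemma PW_graphs_eq:
  "PW_graphs p m n = (SIGMA Ts:tree_lists p n m. {I. partition_on (set (leaves1 Ts)) I})"
proof -
  have "(\<exists>j. (\<forall>i<n. Ts ! i \<in> trees p (j i)) \<and> (\<Sum>i<n. j i) = m) \<longleftrightarrow> Ts \<in> tree_lists p n m"
    if len: "length Ts = n" for Ts
  proof -
    have "sum_list (map num_inner Ts) = (\<Sum>i<n. num_inner (Ts ! i))"
      using len by (simp add: sum_list_sum_nth atLeast0LessThan)
    then show ?thesis
      using len by (auto simp: tree_lists_def trees_def set_conv_nth
          intro!: exI[of _ "\<lambda>i. num_inner (Ts ! i)"])
  qed
  moreover have "length Ts = n" if "Ts \<in> tree_lists p n m" for Ts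
    using that by (simp add: tree_lists_def)
  ultimately show ?thesis
    by (auto simp: PW_graphs_def)
qed

text \<open>At fixed positions of the inner vertices the full moment is a finite sum over partitions
  of the leaves. Convergence for each single graph allows this sum to be taken out of the
  integral.\<close>

lemma forest_moment_eq_sum_graph_values:
  fixes x :: "nat \<Rightarrow> 'd::finite point"
  assumes mom: "moment \<mu> [] = 1"
    and conv: "graph_integrals_converge \<delta> m0 p f D \<mu>"
    and Ts: "Ts \<in> tree_lists p n m" and x: "\<forall>i<n. x i \<in> Gam \<delta>"
  shows "forest_mult Ts * (LINT u|forest_measure \<delta> Ts. forest_kernel \<delta> m0 f Ts x u *
      moment \<mu> (leaf_functions \<delta> m0 x (fst u) (leaves1 Ts))) =
    (\<Sum>I | partition_on (set (leaves1 Ts)) I. graph_value \<delta> m0 f \<mu> (Ts, I) x)"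
proof -
  let ?J = "{I. partition_on (set (leaves1 Ts)) I}"
  have "moment \<mu> (leaf_functions \<delta> m0 x y (leaves1 Ts)) = (\<Sum>I\<in>?J. \<Prod>B\<in>I.
      truncated \<mu> (leaf_functions \<delta> m0 x y (filter (\<lambda>v. v \<in> B) (leaves1 Ts))))" for y
  proof -
    have "moment \<mu> (leaf_functions \<delta> m0 x y (leaves1 Ts)) =
        (\<Sum>I | partition_on {..<length (leaves1 Ts)} I. \<Prod>B\<in>I.
          truncated \<mu> (leaf_functions \<delta> m0 x y (nths (leaves1 Ts) B)))"
      by (simp add: moment_eq_sum_truncated[OF mom] leaf_functions_def nths_map)
    then show ?thesis
      by (simp only: sum_partitions_nths[OF distinct_leaves1,
          where h = "\<lambda>vs. truncated \<mu> (leaf_functions \<delta> m0 x y vs)"])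
  qed
  then have "(LINT u|forest_measure \<delta> Ts. forest_kernel \<delta> m0 f Ts x u *
      moment \<mu> (leaf_functions \<delta> m0 x (fst u) (leaves1 Ts))) =
      (LINT u|forest_measure \<delta> Ts. (\<Sum>I\<in>?J. graph_integrand \<delta> m0 f \<mu> (Ts, I) x u))"
    by (simp add: graph_integrand_def sum_distrib_left)
  also have "\<dots> = (\<Sum>I\<in>?J. LINT u|forest_measure \<delta> Ts. graph_integrand \<delta> m0 f \<mu> (Ts, I) x u)"
  proof (rule Bochner_Integration.integral_sum)
    fix I assume "I \<in> ?J"
    then have "(Ts, I) \<in> PW_graphs p m n" using Ts by (simp add: PW_graphs_eq)
    then have "integrable (forest_measure \<delta> (fst (Ts, I))) (graph_integrand \<delta> m0 f \<mu> (Ts, I) x)"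
      using conv x unfolding graph_integrals_converge_def by blast
    then show "integrable (forest_measure \<delta> Ts) (graph_integrand \<delta> m0 f \<mu> (Ts, I) x)" by simp
  qed
  finally show ?thesis
    by (simp add: graph_value_def sum_distrib_left)
qed

lemma fps_nth_prod_X_series:
  fixes x :: "nat \<Rightarrow> 'd::finite point"
  assumes "g \<in> borel_measurable (Gam_measure \<delta>)" "tree_integrals_converge \<delta> m0 p f g"
    and "\<forall>i<n. x i \<in> Gam \<delta>"
  shows "fps_nth (\<Prod>i<n. X_series \<delta> m0 p f g (x i)) m =
    (-1) ^ m * (\<Sum>Ts\<in>tree_lists p n m. \<Prod>i<n. tree_value \<delta> m0 f g (Ts ! i) (x i))"
proof -
  have "(\<Prod>i<n. X_series \<delta> m0 p f g (x i)) =
      (\<Prod>i<n. Abs_fps (\<lambda>j. (-1) ^ j * (\<Sum>T\<in>trees p j. tree_value \<delta> m0 f g T (x i))))"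
    using assms by (intro prod.cong refl) (simp add: X_series_def X_coeff_eq_sum_trees)
  then show ?thesis by (simp only: fps_nth_prod_trees)
qed

theorem theorem4p6:
  fixes \<delta> m0 :: real and p n :: nat
    and f :: "real ^ 'd::finite \<Rightarrow> real"
    and M :: "'w measure"
    and \<eta> :: "'w \<Rightarrow> ('d point \<Rightarrow> real) \<Rightarrow> real"
    and Y :: "'w \<Rightarrow> 'd point \<Rightarrow> real"
    and D :: "nat \<Rightarrow> ((nat \<Rightarrow> 'd point) \<Rightarrow> real) set"
    and \<mu> :: "nat \<Rightarrow> ((nat \<Rightarrow> 'd point) \<Rightarrow> real) \<Rightarrow> real"
    and x :: "nat \<Rightarrow> 'd point"
  assumes "\<delta> > 0" and "m0 > 0" and "p \<ge> 1"
    and "f \<in> schwartz_lat \<delta>"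
    and "prob_space M"
    and "random_noise M \<delta> \<eta>"
    and "case_prod Y \<in> borel_measurable (M \<Otimes>\<^sub>M Gam_measure \<delta>)"
    and "AE \<omega> in M. Y \<omega> \<in> Mb \<delta> \<and> is_green_conv \<delta> m0 (\<eta> \<omega>) (Y \<omega>)"
    and "moment_functions M \<delta> \<eta> D \<mu>"
    and "AE \<omega> in M. tree_integrals_converge \<delta> m0 p f (Y \<omega>)"
    and "graph_integrals_converge \<delta> m0 p f D \<mu>"
    and "tree_expectations_by_moments M \<delta> m0 p f Y \<mu>"
    and "n \<ge> 1" and "\<forall>i<n. x i \<in> Gam \<delta>"
  shows "fps_expectation M (\<lambda>\<omega>. \<Prod>i<n. X_series \<delta> m0 p f (Y \<omega>) (x i)) =
    Abs_fps (\<lambda>m. (-1) ^ m * (\<Sum>\<G>\<in>PW_graphs p m n. graph_value \<delta> m0 f \<mu> \<G> x))"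
proof (rule fps_ext)
  fix m
  interpret prob_space M by fact
  note Y = assms(7) and conv = assms(10) and x = assms(14)
  let ?S = "tree_lists p n m"
  let ?V = "\<lambda>Ts \<omega>. \<Prod>i<n. tree_value \<delta> m0 f (Y \<omega>) (Ts ! i) (x i)"
  \<comment> \<open>The empty list of test functions gives the expectation of the empty product,
    which is 1 for a probability measure.\<close>
  have mom: "moment \<mu> [] = 1"
    using assms(9)[unfolded moment_functions_def, THEN conjunct2, THEN conjunct2, rule_format, of "[]"]
    by (simp add: moment_def prob_space)
  have E: "integrable M (?V Ts)" "(LINT \<omega>|M. ?V Ts \<omega>) =
      (\<Sum>I | partition_on (set (leaves1 Ts)) I. graph_value \<delta> m0 f \<mu> (Ts, I) x)" if "Ts \<in> ?S" for Ts
  proof -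
    have "length Ts = n" "\<forall>T\<in>set Ts. \<exists>j. T \<in> trees p j"
      using that by (auto simp: tree_lists_def trees_def)
    then have "integrable M (?V Ts) \<and> (LINT \<omega>|M. ?V Ts \<omega>) =
        forest_mult Ts * (LINT u|forest_measure \<delta> Ts. forest_kernel \<delta> m0 f Ts x u *
          moment \<mu> (leaf_functions \<delta> m0 x (fst u) (leaves1 Ts)))"
      using assms(12) x unfolding tree_expectations_by_moments_def by blast
    then show "integrable M (?V Ts)" "(LINT \<omega>|M. ?V Ts \<omega>) =
      (\<Sum>I | partition_on (set (leaves1 Ts)) I. graph_value \<delta> m0 f \<mu> (Ts, I) x)"
      using forest_moment_eq_sum_graph_values[OF mom assms(11) that x] by simp_all
  qed
  have "fps_nth (fps_expectation M (\<lambda>\<omega>. \<Prod>i<n. X_series \<delta> m0 p f (Y \<omega>) (x i))) m =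
      (LINT \<omega>|M. fps_nth (\<Prod>i<n. X_series \<delta> m0 p f (Y \<omega>) (x i)) m)"
    by (simp add: fps_expectation_def)
  also have "\<dots> = (LINT \<omega>|M. (-1) ^ m * (\<Sum>Ts\<in>?S. ?V Ts \<omega>))"
  \<comment> \<open>The tree expansion holds only almost surely, where the tree integrals converge,
    so measurability of both sides is shown separately.\<close>
  proof (rule integral_cong_AE)
    show "(\<lambda>\<omega>. fps_nth (\<Prod>i<n. X_series \<delta> m0 p f (Y \<omega>) (x i)) m) \<in> borel_measurable M"
    proof (rule borel_measurable_fps_nth_prod)
      fix i k assume "i < n"
      then show "(\<lambda>\<omega>. fps_nth (X_series \<delta> m0 p f (Y \<omega>) (x i)) k) \<in> borel_measurable M"
        using x by (simp add: X_series_def borel_measurable_times borel_measurable_X_coeff_at[OF Y])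
    qed
    show "(\<lambda>\<omega>. (-1) ^ m * (\<Sum>Ts\<in>?S. ?V Ts \<omega>)) \<in> borel_measurable M"
      using E(1) by (intro borel_measurable_times borel_measurable_const borel_measurable_sum
          borel_measurable_integrable)
    show "AE \<omega> in M. fps_nth (\<Prod>i<n. X_series \<delta> m0 p f (Y \<omega>) (x i)) m = (-1) ^ m * (\<Sum>Ts\<in>?S. ?V Ts \<omega>)"
      using conv AE_space
    proof eventually_elim
      case (elim \<omega>)
      have "Y \<omega> \<in> borel_measurable (Gam_measure \<delta>)"
        using measurable_Pair2[OF Y elim(2)] by simp
      from fps_nth_prod_X_series[OF this elim(1) x] show ?case .
    qed
  qed
  also have "\<dots> = (-1) ^ m * (\<Sum>Ts\<in>?S. LINT \<omega>|M. ?V Ts \<omega>)"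
    using E(1) by simp
  also have "\<dots> = (-1) ^ m * (\<Sum>\<G>\<in>PW_graphs p m n. graph_value \<delta> m0 f \<mu> \<G> x)"
    by (simp add: E(2) PW_graphs_eq sum.Sigma finite_tree_lists finitely_many_partition_on)
  finally show "fps_nth (fps_expectation M (\<lambda>\<omega>. \<Prod>i<n. X_series \<delta> m0 p f (Y \<omega>) (x i))) m =
      fps_nth (Abs_fps (\<lambda>m. (-1) ^ m * (\<Sum>\<G>\<in>PW_graphs p m n. graph_value \<delta> m0 f \<mu> \<G> x))) m"
    by simp
qed

end
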